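(* Let $\Omega\downarrow_p\Delta$ be a biased expansion of a $2$-connected graph $\Delta$, and let $\Omega'\downarrow_{p'}\Delta'$ and $\Omega''\downarrow_{p''}\Delta'$ be two extensions of $\Omega$ to the same graph $\Delta'$. Then there is a unique isomorphism of biased graphs $\rho:\Omega'\to\Omega''$ that is the identity on $\Omega$ and satisfies $p''\circ\rho=p'$ (the last condition is automatic when $\Delta'$ is simple).
   Context: A biased graph is a graph with a set of circles, called balanced, such that no theta subgraph contains exactly two balanced circles. A biased expansion of $\Delta$ is a biased graph $\Omega$ with surjective $p:\|\Omega\|\to\Delta$, identity on nodes, no balanced digon in any fiber, and the circle lifting property (for every circle $e_1\cdots e_l$ of $\Delta$ and any $\tilde e_i\in p^{-1}(e_i)$, $i<l$, exactly one $\tilde e_l\in p^{-1}(e_l)$ makes $\tilde e_1\cdots\tilde e_l$ balanced). An extension of $\Omega\downarrow_p\Delta$ is a biased expansion $\Omega'\downarrow_{p'}\Delta'$ such that $\Delta$ is a spanning subgraph of $\Delta'$ and $p'^{-1}(\Delta)$ with its inherited balanced circles and projection equals $\Omega$. An isomorphism of biased graphs is a graph isomorphism carrying balanced circles exactly onto balanced circles. A graph is $2$-connected if any two edges lie on a common circle.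
   Formalization: Graphs are taken to be loopless, and a 2-connected graph is also required to be connected (no isolated nodes beside others); with a loop in Δ′, or an isolated node of Δ joined by an isthmus in Δ′, fiber sizes are undetermined and the claim fails. *)

theory Defs
  imports Main "HOL-Library.FuncSet"
begin

text \<open>Graphs may be infinite and may have parallel edges, but have no loops; an edge is
  an object of its own whose endpoints form a two-element set.\<close>

record ('v, 'e) mgraph =
  nodes :: "'v set"
  edges :: "'e set"
  ends :: "'e \<Rightarrow> 'v set"

record ('v, 'e) biased_mgraph = "('v, 'e) mgraph" +
  balanced :: "'e set set"

definition graph :: "('v, 'e, 'z) mgraph_scheme \<Rightarrow> bool" where
  "graph G \<longleftrightarrow> (\<forall>e\<in>edges G. ends G e \<subseteq> nodes G \<and> card (ends G e) = 2)"

definition simple :: "('v, 'e, 'z) mgraph_scheme \<Rightarrow> bool" where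
  "simple G \<longleftrightarrow> inj_on (ends G) (edges G)"

fun walk :: "('v, 'e, 'z) mgraph_scheme \<Rightarrow> 'v list \<Rightarrow> 'e list \<Rightarrow> bool" where
  "walk G [v] [] \<longleftrightarrow> v \<in> nodes G"
| "walk G (u # v # vs) (e # es) \<longleftrightarrow>
     u \<in> nodes G \<and> e \<in> edges G \<and> ends G e = {u, v} \<and> walk G (v # vs) es"
| "walk G _ _ \<longleftrightarrow> False"

definition path_between ::
    "('v, 'e, 'z) mgraph_scheme \<Rightarrow> 'v \<Rightarrow> 'v \<Rightarrow> 'v list \<Rightarrow> 'e list \<Rightarrow> bool" where
  "path_between G u v vs es \<longleftrightarrow>
     walk G vs es \<and> distinct vs \<and> hd vs = u \<and> last vs = v"

text \<open>A circle is a simple closed path.  Its edges can be listed in cyclic order starting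
  anywhere and in either direction; as an object it is identified with its edge set.
  Distinctness of the edges only matters at length 2.\<close>

definition circle_seq :: "('v, 'e, 'z) mgraph_scheme \<Rightarrow> 'e list \<Rightarrow> bool" where
  "circle_seq G es \<longleftrightarrow> es \<noteq> [] \<and> distinct es \<and>
     (\<exists>vs. walk G vs es \<and> hd vs = last vs \<and> distinct (tl vs))"

definition circle :: "('v, 'e, 'z) mgraph_scheme \<Rightarrow> 'e set \<Rightarrow> bool" where
  "circle G C \<longleftrightarrow> (\<exists>es. circle_seq G es \<and> C = set es)"

definition connected_graph :: "('v, 'e, 'z) mgraph_scheme \<Rightarrow> bool" where
  "connected_graph G \<longleftrightarrow>
     (\<forall>u\<in>nodes G. \<forall>v\<in>nodes G. \<exists>vs es. path_between G u v vs es)"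

text \<open>Connectedness only excludes isolated nodes (beside other nodes), which the
  condition on edges does not see.\<close>

definition two_connected :: "('v, 'e, 'z) mgraph_scheme \<Rightarrow> bool" where
  "two_connected G \<longleftrightarrow> connected_graph G \<and>
     (\<forall>e\<in>edges G. \<forall>f\<in>edges G. e \<noteq> f \<longrightarrow> (\<exists>C. circle G C \<and> e \<in> C \<and> f \<in> C))"

definition theta :: "('v, 'e, 'z) mgraph_scheme \<Rightarrow> 'e set \<Rightarrow> bool" where
  "theta G T \<longleftrightarrow> (\<exists>u v vs1 es1 vs2 es2 vs3 es3. u \<noteq> v \<and>
     path_between G u v vs1 es1 \<and> path_between G u v vs2 es2 \<and> path_between G u v vs3 es3 \<and>
     set vs1 \<inter> set vs2 = {u, v} \<and> set vs1 \<inter> set vs3 = {u, v} \<and> set vs2 \<inter> set vs3 = {u, v} \<and>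
     set es1 \<inter> set es2 = {} \<and> set es1 \<inter> set es3 = {} \<and> set es2 \<inter> set es3 = {} \<and>
     T = set es1 \<union> set es2 \<union> set es3)"

definition biased_graph :: "('v, 'e) biased_mgraph \<Rightarrow> bool" where
  "biased_graph \<Omega> \<longleftrightarrow> graph \<Omega> \<and> (\<forall>C\<in>balanced \<Omega>. circle \<Omega> C) \<and>
     (\<forall>T. theta \<Omega> T \<longrightarrow> card {C \<in> balanced \<Omega>. C \<subseteq> T} \<noteq> 2)"

definition circle_lifting ::
    "('v, 'e) biased_mgraph \<Rightarrow> ('e \<Rightarrow> 'd) \<Rightarrow> ('v, 'd) mgraph \<Rightarrow> bool" where
  "circle_lifting \<Omega> p \<Delta> \<longleftrightarrow>
     (\<forall>es e fs. circle_seq \<Delta> (es @ [e]) \<and> set fs \<subseteq> edges \<Omega> \<and> map p fs = es \<longrightarrow>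
        (\<exists>!f. f \<in> edges \<Omega> \<and> p f = e \<and> set (fs @ [f]) \<in> balanced \<Omega>))"

text \<open>The projection is the identity on nodes, so it is given by its edge map.\<close>

definition biased_expansion ::
    "('v, 'e) biased_mgraph \<Rightarrow> ('e \<Rightarrow> 'd) \<Rightarrow> ('v, 'd) mgraph \<Rightarrow> bool" where
  "biased_expansion \<Omega> p \<Delta> \<longleftrightarrow> biased_graph \<Omega> \<and> graph \<Delta> \<and>
     nodes \<Omega> = nodes \<Delta> \<and> p ` edges \<Omega> = edges \<Delta> \<and>
     (\<forall>e\<in>edges \<Omega>. ends \<Delta> (p e) = ends \<Omega> e) \<and>
     (\<forall>e\<in>edges \<Omega>. \<forall>f\<in>edges \<Omega>. e \<noteq> f \<and> p e = p f \<longrightarrow> {e, f} \<notin> balanced \<Omega>) \<and>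
     circle_lifting \<Omega> p \<Delta>"

definition spanning_subgraph :: "('v, 'd) mgraph \<Rightarrow> ('v, 'd) mgraph \<Rightarrow> bool" where
  "spanning_subgraph \<Delta> \<Delta>' \<longleftrightarrow> nodes \<Delta> = nodes \<Delta>' \<and> edges \<Delta> \<subseteq> edges \<Delta>' \<and>
     (\<forall>e\<in>edges \<Delta>. ends \<Delta> e = ends \<Delta>' e)"

text \<open>The conditions after the spanning subgraph say that the preimage of \<open>\<Delta>\<close> under \<open>p'\<close>,
  with inherited balanced circles and projection, is \<open>\<Omega>\<close>; functions on edges are compared
  on edges only.\<close>

definition extension ::
    "('v, 'e) biased_mgraph \<Rightarrow> ('e \<Rightarrow> 'd) \<Rightarrow> ('v, 'd) mgraph \<Rightarrow>
     ('v, 'e) biased_mgraph \<Rightarrow> ('e \<Rightarrow> 'd) \<Rightarrow> ('v, 'd) mgraph \<Rightarrow> bool" where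
  "extension \<Omega> p \<Delta> \<Omega>' p' \<Delta>' \<longleftrightarrow> biased_expansion \<Omega>' p' \<Delta>' \<and> spanning_subgraph \<Delta> \<Delta>' \<and>
     nodes \<Omega> = {v \<in> nodes \<Omega>'. v \<in> nodes \<Delta>} \<and>
     edges \<Omega> = {e \<in> edges \<Omega>'. p' e \<in> edges \<Delta>} \<and>
     (\<forall>e\<in>edges \<Omega>. ends \<Omega> e = ends \<Omega>' e) \<and>
     balanced \<Omega> = {C \<in> balanced \<Omega>'. C \<subseteq> edges \<Omega>} \<and>
     (\<forall>e\<in>edges \<Omega>. p e = p' e)"

text \<open>An isomorphism is a pair of a node map and an edge map.  Both are extensional, so that
  equality of isomorphisms means agreement on nodes and edges.\<close>

definition graph_iso ::
    "('v, 'e, 'y) mgraph_scheme \<Rightarrow> ('w, 'f, 'z) mgraph_scheme \<Rightarrow>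
     ('v \<Rightarrow> 'w) \<times> ('e \<Rightarrow> 'f) \<Rightarrow> bool" where
  "graph_iso G H \<rho> \<longleftrightarrow>
     fst \<rho> \<in> extensional (nodes G) \<and> snd \<rho> \<in> extensional (edges G) \<and>
     bij_betw (fst \<rho>) (nodes G) (nodes H) \<and> bij_betw (snd \<rho>) (edges G) (edges H) \<and>
     (\<forall>e\<in>edges G. ends H (snd \<rho> e) = fst \<rho> ` ends G e)"

definition biased_graph_iso ::
    "('v, 'e) biased_mgraph \<Rightarrow> ('w, 'f) biased_mgraph \<Rightarrow> ('v \<Rightarrow> 'w) \<times> ('e \<Rightarrow> 'f) \<Rightarrow> bool" where
  "biased_graph_iso \<Omega> \<Omega>' \<rho> \<longleftrightarrow>
     graph_iso \<Omega> \<Omega>' \<rho> \<and> (\<lambda>C. snd \<rho> ` C) ` balanced \<Omega> = balanced \<Omega>'"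

definition identity_on ::
    "('v, 'e) biased_mgraph \<Rightarrow> ('v \<Rightarrow> 'v) \<times> ('e \<Rightarrow> 'e) \<Rightarrow> bool" where
  "identity_on \<Omega> \<rho> \<longleftrightarrow> (\<forall>v\<in>nodes \<Omega>. fst \<rho> v = v) \<and> (\<forall>e\<in>edges \<Omega>. snd \<rho> e = e)"

text \<open>Commutation with the projections, on nodes (where these are the identity) and on edges.\<close>

definition commutes_with_projections ::
    "('v, 'e) biased_mgraph \<Rightarrow> ('e \<Rightarrow> 'd) \<Rightarrow> ('e \<Rightarrow> 'd) \<Rightarrow>
     ('v \<Rightarrow> 'v) \<times> ('e \<Rightarrow> 'e) \<Rightarrow> bool" where
  "commutes_with_projections \<Omega>' p' p'' \<rho> \<longleftrightarrow>
     (\<forall>v\<in>nodes \<Omega>'. fst \<rho> v = v) \<and> (\<forall>e\<in>edges \<Omega>'. p'' (snd \<rho> e) = p' e)"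

end

theory Submission
  imports Defs
begin

text \<open>Let \<open>e\<close> be an edge of \<open>\<Delta>'\<close> outside \<open>\<Delta>\<close>.  Since \<open>\<Delta>\<close> is 2-connected, the ends of \<open>e\<close> are joined
  in \<open>\<Delta>\<close> by two internally disjoint paths \<open>P\<close> and \<open>Q\<close> (unless \<open>\<Delta>\<close> is a single edge).  An edge \<open>f\<close>
  of \<open>\<Omega>'\<close> over \<open>e\<close> is sent to the edge \<open>g\<close> of \<open>\<Omega>''\<close> over \<open>e\<close> that closes one lift of \<open>P\<close> to a
  balanced circle together with \<open>f\<close>; the theta property, applied to lifts of \<open>P\<close>, \<open>Q\<close> and \<open>e\<close>, shows
  that \<open>f\<close> and \<open>g\<close> then close exactly the same lifts of \<open>P\<close>.  No other choice is possible, which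
  gives uniqueness.

  That balance is preserved is shown by induction on the number of edges of a circle \<open>C\<close> of \<open>\<Delta>'\<close>
  outside \<open>\<Delta>\<close>.  Take such an edge \<open>e\<close> and the path \<open>P\<close> above.  The path \<open>P\<close> is transformed into
  \<open>C - e\<close> by exchanging one segment at a time; each exchange takes place in a theta graph whose third
  circle consists of a piece of \<open>P\<close> and a piece of \<open>C - e\<close>, hence has fewer edges outside \<open>\<Delta>\<close>.\<close>

subsection \<open>Walks, paths and circles\<close>

lemma walk_nonempty: "walk G vs es \<Longrightarrow> vs \<noteq> []"
  by (cases vs) auto

lemma walk_Cons_iff:
  "walk G (u # vs) (e # es) \<longleftrightarrow>
     vs \<noteq> [] \<and> u \<in> nodes G \<and> e \<in> edges G \<and> ends G e = {u, hd vs} \<and> walk G vs es"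
  by (cases vs) auto

lemma walk_Nil_iff: "walk G vs [] \<longleftrightarrow> (\<exists>v\<in>nodes G. vs = [v])"
  by (cases "(G, vs, [] :: 'b list)" rule: walk.cases) auto

lemma walk_single_iff: "walk G [v] es \<longleftrightarrow> v \<in> nodes G \<and> es = []"
  by (cases es) auto

lemma walk_subsets:
  "walk G vs es \<Longrightarrow> set vs \<subseteq> nodes G \<and> set es \<subseteq> edges G \<and> (\<forall>e\<in>set es. ends G e \<subseteq> set vs)"
  by (induction G vs es rule: walk.induct) auto

lemma walk_append:
  "walk G (us @ [x]) es \<Longrightarrow> walk G (x # ws) fs \<Longrightarrow> walk G (us @ x # ws) (es @ fs)"
proof (induction us arbitrary: es)
  case Nil
  then show ?case by (auto simp: walk_single_iff)
next
  case (Cons a us)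
  then obtain e es' where "es = e # es'"
    by (cases es) (auto simp: walk_Nil_iff)
  with Cons show ?case by (cases us) (auto simp: walk_Cons_iff)
qed

lemma walk_split:
  "walk G (us @ x # ws) es \<Longrightarrow>
     \<exists>es1 es2. es = es1 @ es2 \<and> walk G (us @ [x]) es1 \<and> walk G (x # ws) es2"
proof (induction us arbitrary: es)
  case Nil
  then have "x \<in> nodes G" using walk_subsets by fastforce
  with Nil show ?case by (intro exI[of _ "[]"] exI[of _ es]) auto
next
  case (Cons a us)
  then obtain e es' where es: "es = e # es'"
    by (cases es) (auto simp: walk_Nil_iff)
  with Cons.prems have w: "walk G (us @ x # ws) es'" by (auto simp: walk_Cons_iff)
  then obtain es1 es2 where "es' = es1 @ es2" "walk G (us @ [x]) es1" "walk G (x # ws) es2"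
    using Cons.IH by blast
  moreover have "walk G ((a # us) @ [x]) (e # es1)"
    using Cons.prems es \<open>walk G (us @ [x]) es1\<close> by (cases us) (auto simp: walk_Cons_iff)
  ultimately show ?case using es by (metis append_Cons)
qed

lemma walk_split_edge:
  "walk G vs (es1 @ e # es2) \<Longrightarrow>
     \<exists>us x y ws. vs = us @ x # y # ws \<and> walk G (us @ [x]) es1 \<and> walk G (y # ws) es2 \<and>
       e \<in> edges G \<and> ends G e = {x, y}"
proof (induction es1 arbitrary: vs)
  case Nil
  then show ?case
    by (cases "(G, vs, e # es2)" rule: walk.cases) (auto intro!: exI[of _ "[]"])
next
  case (Cons a es1)
  from Cons.prems obtain u vs' where vs: "vs = u # vs'"
    by (cases vs) auto
  with Cons.prems have w: "walk G vs' (es1 @ e # es2)" by (auto simp: walk_Cons_iff)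
  then obtain us x y ws where *: "vs' = us @ x # y # ws" "walk G (us @ [x]) es1"
      "walk G (y # ws) es2" "e \<in> edges G" "ends G e = {x, y}"
    using Cons.IH by blast
  have "walk G ((u # us) @ [x]) (a # es1)"
    using Cons.prems vs * by (cases us) (auto simp: walk_Cons_iff)
  with * vs show ?case by (metis append_Cons)
qed

lemma walk_join_edge:
  "walk G vs es \<Longrightarrow> walk G ws fs \<Longrightarrow> e \<in> edges G \<Longrightarrow> ends G e = {last vs, hd ws} \<Longrightarrow>
     walk G (vs @ ws) (es @ e # fs)"
proof (induction G vs es rule: walk.induct)
  case (1 G v)
  then show ?case using walk_nonempty[of G ws fs] by (auto simp: walk_Cons_iff)
qed auto

lemma walk_rev: "walk G vs es \<Longrightarrow> walk G (rev vs) (rev es)"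
proof (induction G vs es rule: walk.induct)
  case (2 G u v vs e es)
  then show ?case
    using walk_join_edge[of G "rev (v # vs)" "rev es" "[u]" "[]" e]
    by (auto simp: insert_commute last_rev)
qed auto

lemma walk_map:
  assumes "walk G vs es" "nodes G \<subseteq> nodes H"
    and "\<And>e. e \<in> set es \<Longrightarrow> h e \<in> edges H \<and> ends H (h e) = ends G e"
  shows "walk H vs (map h es)"
  using assms by (induction G vs es rule: walk.induct) auto

lemma path_rev: "path_between G u v vs es \<Longrightarrow> path_between G v u (rev vs) (rev es)"
  using walk_nonempty[of G vs es]
  by (auto simp: path_between_def hd_rev last_rev intro: walk_rev)

lemma path_map:
  assumes "path_between G u v vs es" "nodes G \<subseteq> nodes H"
    and "\<And>e. e \<in> set es \<Longrightarrow> h e \<in> edges H \<and> ends H (h e) = ends G e"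
  shows "path_between H u v vs (map h es)"
  using assms walk_map unfolding path_between_def by blast

lemma path_subset_edges: "path_between G u v vs es \<Longrightarrow> set es \<subseteq> edges G"
  using walk_subsets unfolding path_between_def by blast

lemma path_edge_nodes: "path_between G u v vs es \<Longrightarrow> e \<in> set es \<Longrightarrow> ends G e \<subseteq> set vs"
  using walk_subsets unfolding path_between_def by blast

lemma path_end_nodes: "path_between G u v vs es \<Longrightarrow> u \<in> set vs \<and> v \<in> set vs"
  using walk_nonempty unfolding path_between_def by force

lemma path_edges_nonempty: "path_between G u v vs es \<Longrightarrow> u \<noteq> v \<Longrightarrow> es \<noteq> []"
  by (auto simp: path_between_def walk_Nil_iff)

lemma path_single_edge:
  "e \<in> edges G \<Longrightarrow> ends G e = {u, v} \<Longrightarrow> u \<noteq> v \<Longrightarrow> graph G \<Longrightarrow> path_between G u v [u, v] [e]"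
  by (auto simp: path_between_def graph_def)

text \<open>A path leaves its initial node at once and never returns to it, its nodes being
  distinct. Applied at the common ends of the three paths of a theta graph, this counts the edges of
  a circle there.\<close>

lemma path_first_edge:
  assumes "path_between G u v vs es" "u \<noteq> v"
  shows "\<exists>a\<in>set es. u \<in> ends G a \<and> (\<forall>g\<in>set es. u \<in> ends G g \<longrightarrow> g = a)"
proof -
  obtain a es' where es: "es = a # es'"
    using path_edges_nonempty[OF assms] by (cases es) auto
  obtain w ws where vs: "vs = u # w # ws"
    using assms es by (auto simp: path_between_def elim: walk.elims)
  have "u \<notin> set (w # ws)" "walk G (w # ws) es'" "ends G a = {u, w}"
    using assms es vs by (auto simp: path_between_def)
  then show ?thesis using walk_subsets[of G "w # ws" es'] es by auto
qed

text \<open>The first edge contains the initial node, and no later edge does.\<close>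

lemma path_edges_distinct: "walk G vs es \<Longrightarrow> distinct vs \<Longrightarrow> distinct es"
proof (induction G vs es rule: walk.induct)
  case (2 G u v vs e es)
  then show ?case using walk_subsets[of G "v # vs" es] by auto
qed auto

text \<open>Only the first edge meets the initial node, so an edge joining both ends is the first
  one. The second node is then already the last.\<close>

lemma path_edge_joining_ends:
  assumes "path_between G u v vs es" "e \<in> set es" "ends G e = {u, v}" "u \<noteq> v"
  shows "es = [e]"
proof -
  obtain a es' where es: "es = a # es'" using assms by (cases es) auto
  obtain w ws where vs: "vs = u # w # ws"
    using assms es by (auto simp: path_between_def elim: walk.elims)
  have *: "u \<notin> set (w # ws)" "walk G (w # ws) es'" "ends G a = {u, w}" "distinct (w # ws)"
      "last (w # ws) = v"
    using assms es vs by (auto simp: path_between_def)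
  then have "e = a" using walk_subsets[of G "w # ws" es'] es assms by auto
  then have "w = v" using * assms by (auto simp: doubleton_eq_iff)
  then have "ws = []" using * by (cases ws rule: rev_cases) auto
  then show ?thesis using * es \<open>e = a\<close> by (simp add: walk_single_iff)
qed

text \<open>The witness is the node between \<open>a\<close> and \<open>b\<close>, which occurs on
  the path only there. A circle in a theta graph that enters this node along one of the two edges
  has to leave it along the other.\<close>

lemma path_interior_node:
  assumes "path_between G u v vs (es1 @ a # b # es2)"
  shows "\<exists>x\<in>set vs. x \<noteq> u \<and> x \<noteq> v \<and> x \<in> ends G a \<and> x \<in> ends G b \<and>
           (\<forall>g\<in>set (es1 @ a # b # es2). x \<in> ends G g \<longrightarrow> g = a \<or> g = b)"
proof -
  obtain us w x ws where vs: "vs = us @ w # x # ws" and w1: "walk G (us @ [w]) es1"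
      and w2: "walk G (x # ws) (b # es2)" and a: "ends G a = {w, x}"
    using walk_split_edge[of G vs es1 a "b # es2"] assms unfolding path_between_def by blast
  from w2 obtain y ws' where ws: "ws = y # ws'" "ends G b = {x, y}" "walk G (y # ws') es2"
    by (cases ws) auto
  have "distinct vs" "hd vs = u" "last vs = v" using assms by (auto simp: path_between_def)
  then have d: "distinct (us @ w # x # y # ws')" and uv: "hd (us @ w # x # y # ws') = u"
      "last (us @ w # x # y # ws') = v"
    using vs ws(1) by auto
  have "x \<notin> set (us @ [w])" "x \<notin> set (y # ws')" using d by auto
  moreover have "u \<in> set (us @ [w])" using uv(1) by (cases us) auto
  moreover have "v \<in> set (y # ws')" using uv(2) last_in_set[of "y # ws'"] by simp
  ultimately have x: "x \<notin> set (us @ [w])" "x \<notin> set (y # ws')" "x \<noteq> u" "x \<noteq> v"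
    by blast+
  have "\<forall>g\<in>set es1. x \<notin> ends G g" "\<forall>g\<in>set es2. x \<notin> ends G g"
    using walk_subsets[OF w1] walk_subsets[OF ws(3)] x(1,2) by blast+
  then have "\<forall>g\<in>set (es1 @ a # b # es2). x \<in> ends G g \<longrightarrow> g = a \<or> g = b" by auto
  moreover have "x \<in> set vs" "x \<in> ends G a" "x \<in> ends G b" using vs a ws(2) by auto
  ultimately show ?thesis using x(3,4) by blast
qed

text \<open>The closed walk follows the first path and returns along the reverse of the second.
  Disjointness of the edges excludes that both paths are the same single edge.\<close>

lemma circle_of_paths:
  assumes "path_between G u v vs es" "path_between G u v ws fs" "u \<noteq> v"
    and "set vs \<inter> set ws = {u, v}" "set es \<inter> set fs = {}"
  shows "circle G (set es \<union> set fs)"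
proof -
  obtain vs' where vs: "vs = u # vs'" "u \<notin> set vs'" "distinct vs'" "last vs' = v" "vs' \<noteq> []"
    using assms(1,3) by (cases vs) (auto simp: path_between_def split: if_splits)
  then have vs2: "vs = (u # butlast vs') @ [v]" using append_butlast_last_id[of vs'] by simp
  have w: "ws \<noteq> []" "distinct ws" "hd ws = u" "last ws = v" and wv: "walk G vs es" "walk G ws fs"
    using assms(1,2) walk_nonempty by (auto simp: path_between_def)
  define ws' where "ws' = butlast ws"
  have ws: "ws = ws' @ [v]" using w ws'_def append_butlast_last_id[of ws] by simp
  with w have ws: "ws = ws' @ [v]" "v \<notin> set ws'" "distinct ws'" by auto
  then have ws: "ws = ws' @ [v]" "v \<notin> set ws'" "distinct ws'" "ws' \<noteq> []" "hd ws' = u"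
    using w(3) assms(3) by (cases ws'; simp)+
  have "walk G (v # rev ws') (rev fs)"
    using walk_rev[OF wv(2)] ws(1) by simp
  moreover have "walk G ((u # butlast vs') @ [v]) es" using wv(1) vs2 by simp
  ultimately have "walk G ((u # butlast vs') @ v # rev ws') (es @ rev fs)"
    by (intro walk_append)
  then have "walk G (vs @ rev ws') (es @ rev fs)" using vs2 by simp
  moreover have "set vs' \<inter> set ws' = {}" using assms(4) vs(1,2) ws(1,2) by fastforce
  then have "distinct (tl (vs @ rev ws'))" using vs(1,3) ws(3) by simp
  moreover have "hd (vs @ rev ws') = last (vs @ rev ws')"
    using vs(1) ws(4,5) by (simp add: last_rev)
  moreover have "es \<noteq> []" using path_edges_nonempty[OF assms(1,3)] .
  moreover have "distinct es" "distinct fs"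
    using path_edges_distinct[OF wv(1)] path_edges_distinct[OF wv(2)] assms(1,2)
    by (simp_all add: path_between_def)
  then have "distinct (es @ rev fs)" using assms(5) by simp
  moreover have "set es \<union> set fs = set (es @ rev fs)" by simp
  ultimately show ?thesis unfolding circle_def circle_seq_def by blast
qed

text \<open>The closing edge is listed last because this is the position that
  \<open>circle_lifting\<close> fills.\<close>

lemma circle_seq_path_edge:
  assumes "path_between G u v vs es" "graph G" "e \<in> edges G" "ends G e = {u, v}" "e \<notin> set es"
  shows "circle_seq G (es @ [e])"
proof -
  have "u \<in> nodes G" using assms by (auto simp: graph_def)
  then have "walk G (vs @ [u]) (es @ [e])"
    using walk_join_edge[of G vs es "[u]" "[]" e] assms by (auto simp: path_between_def)
  then show ?thesis
    using assms walk_nonempty[of G vs es] path_edges_distinct[of G vs es]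
    unfolding circle_seq_def path_between_def
    by (cases vs) (auto intro!: exI[of _ "vs @ [u]"])
qed

lemma graph_endsD: "graph G \<Longrightarrow> e \<in> edges G \<Longrightarrow> ends G e = {u, v} \<Longrightarrow> u \<noteq> v"
  by (auto simp: graph_def card_insert_if)

lemma graph_endsE:
  assumes "graph G" "e \<in> edges G"
  obtains u v where "ends G e = {u, v}" "u \<noteq> v" "u \<in> nodes G" "v \<in> nodes G"
  using assms by (auto simp: graph_def card_2_iff)

section \<open>Circles with one edge removed\<close>

lemma circle_subset_edges: "circle G C \<Longrightarrow> C \<subseteq> edges G"
  using walk_subsets unfolding circle_def circle_seq_def by blast

lemma circle_finite: "circle G C \<Longrightarrow> finite C"
  by (auto simp: circle_def)

text \<open>The closed walk may start anywhere, so it has to be rotated: the part after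
  \<open>e\<close> comes first, then the part before \<open>e\<close>. The direction of the
  resulting path is left open here and prescribed in \<open>circle_remove_edge\<close>.\<close>

lemma circle_remove_edge_weak:
  assumes "circle G C" "e \<in> C"
  shows "\<exists>x y vs es. path_between G x y vs es \<and> ends G e = {x, y} \<and> e \<notin> set es \<and>
           C = insert e (set es)"
proof -
  obtain es0 vs where es0: "distinct es0" "C = set es0"
      and w: "walk G vs es0" "hd vs = last vs" "distinct (tl vs)"
    using assms unfolding circle_def circle_seq_def by blast
  obtain es1 es2 where es: "es0 = es1 @ e # es2" using es0 assms split_list by metis
  obtain us x y ws where vs: "vs = us @ x # y # ws" and w1: "walk G (us @ [x]) es1"
      and w2: "walk G (y # ws) es2" and e: "ends G e = {x, y}"
    using walk_split_edge[of G vs es1 e es2] w(1) es by blast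
  have "walk G (butlast (y # ws) @ [last (y # ws)]) es2"
    using w2 by (metis append_butlast_last_id list.distinct(1))
  \<comment> \<open>The closed walk starts where it ends, so the part before \<open>e\<close> can be
    read as starting at the last node of the part after \<open>e\<close>.\<close>
  moreover have "walk G (last (y # ws) # tl (us @ [x])) es1"
    using w w1 vs by (cases us) auto
  ultimately have "walk G (butlast (y # ws) @ last (y # ws) # tl (us @ [x])) (es2 @ es1)"
    by (rule walk_append)
  moreover have "butlast (y # ws) @ last (y # ws) # tl (us @ [x]) = (y # ws) @ tl (us @ [x])"
    using append_butlast_last_id[of "y # ws"] by (metis append.assoc append_Cons append_Nil list.distinct(1))
  ultimately have "walk G ((y # ws) @ tl (us @ [x])) (es2 @ es1)" by argo
  moreover have "distinct ((y # ws) @ tl (us @ [x]))"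
    using w vs by (cases us) auto
  moreover have "last ((y # ws) @ tl (us @ [x])) = x"
    using w vs by (cases us) auto
  ultimately have "path_between G y x ((y # ws) @ tl (us @ [x])) (es2 @ es1)"
    by (simp add: path_between_def)
  moreover have "ends G e = {y, x}" "e \<notin> set (es2 @ es1)" "C = insert e (set (es2 @ es1))"
    using e es es0 by auto
  ultimately show ?thesis by blast
qed

lemma circle_remove_edge:
  assumes "circle G C" "e \<in> C" "ends G e = {x, y}"
  shows "\<exists>vs es. path_between G x y vs es \<and> e \<notin> set es \<and> C = insert e (set es)"
proof -
  obtain a b vs es where *: "path_between G a b vs es" "ends G e = {a, b}" "e \<notin> set es"
      "C = insert e (set es)"
    using circle_remove_edge_weak assms by metis
  show ?thesis
  proof (cases "x = a \<and> y = b")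
    case True
    then show ?thesis using * by auto
  next
    case False
    then have "x = b \<and> y = a" using * assms(3) by (auto simp: doubleton_eq_iff)
    then show ?thesis using * path_rev[of G a b vs es]
      by (intro exI[of _ "rev vs"] exI[of _ "rev es"]) auto
  qed
qed

text \<open>Removing \<open>e\<close> leaves a path from \<open>x\<close>, which has a single edge
  at \<open>x\<close>. So every node on a circle has degree two in it.\<close>

lemma circle_next_edge:
  assumes "graph G" "circle G C" "e \<in> C" "x \<in> ends G e"
  shows "\<exists>f\<in>C. f \<noteq> e \<and> x \<in> ends G f \<and> (\<forall>g\<in>C. x \<in> ends G g \<longrightarrow> g = e \<or> g = f)"
proof -
  have "e \<in> edges G" using assms circle_subset_edges by blast
  then obtain a b where "ends G e = {a, b}" "a \<noteq> b" using graph_endsE assms(1) by metis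
  then obtain y where y: "ends G e = {x, y}" "x \<noteq> y" using assms(4) by auto
  then obtain vs es where *: "path_between G x y vs es" "e \<notin> set es" "C = insert e (set es)"
    using circle_remove_edge assms by metis
  obtain f where f: "f \<in> set es" "x \<in> ends G f" "\<forall>g\<in>set es. x \<in> ends G g \<longrightarrow> g = f"
    using path_first_edge[OF *(1) y(2)] by blast
  then have "f \<in> C" "f \<noteq> e" "\<forall>g\<in>C. x \<in> ends G g \<longrightarrow> g = e \<or> g = f"
    using *(2) unfolding *(3) by blast+
  with f(2) show ?thesis by blast
qed

text \<open>In the path left after removing \<open>e\<close>, the edge \<open>f\<close> joins the
  two ends, so it is the whole path.\<close>

lemma circle_digon:
  assumes "graph G" "circle G C" "e \<in> C" "f \<in> C" "e \<noteq> f" "ends G e = ends G f"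
  shows "C = {e, f}"
proof -
  have "e \<in> edges G" using assms circle_subset_edges by blast
  then obtain x y where xy: "ends G e = {x, y}" "x \<noteq> y" using graph_endsE assms(1) by metis
  then obtain vs es where *: "path_between G x y vs es" "e \<notin> set es" "C = insert e (set es)"
    using circle_remove_edge assms by metis
  show ?thesis using path_edge_joining_ends[OF *(1), of f] * xy assms by auto
qed

subsection \<open>Theta graphs\<close>

text \<open>While \<open>theta\<close> only remembers the union, the edge sets of the three paths
  are kept apart here, because lifts are taken and exchanged path by path.\<close>

definition theta_parts :: "('v, 'e, 'z) mgraph_scheme \<Rightarrow> 'e set \<Rightarrow> 'e set \<Rightarrow> 'e set \<Rightarrow> bool" where
  "theta_parts G E1 E2 E3 \<longleftrightarrow> (\<exists>u v vs1 es1 vs2 es2 vs3 es3. u \<noteq> v \<and>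
     path_between G u v vs1 es1 \<and> path_between G u v vs2 es2 \<and> path_between G u v vs3 es3 \<and>
     set vs1 \<inter> set vs2 = {u, v} \<and> set vs1 \<inter> set vs3 = {u, v} \<and> set vs2 \<inter> set vs3 = {u, v} \<and>
     set es1 \<inter> set es2 = {} \<and> set es1 \<inter> set es3 = {} \<and> set es2 \<inter> set es3 = {} \<and>
     E1 = set es1 \<and> E2 = set es2 \<and> E3 = set es3)"

lemma theta_partsI:
  assumes "path_between G u v vs1 es1" "path_between G u v vs2 es2" "path_between G u v vs3 es3"
    and "u \<noteq> v"
    and "set vs1 \<inter> set vs2 = {u, v}" "set vs1 \<inter> set vs3 = {u, v}" "set vs2 \<inter> set vs3 = {u, v}"
    and "set es1 \<inter> set es2 = {}" "set es1 \<inter> set es3 = {}" "set es2 \<inter> set es3 = {}"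
  shows "theta_parts G (set es1) (set es2) (set es3)"
  unfolding theta_parts_def
  by (intro exI[of _ u] exI[of _ v] exI[of _ vs1] exI[of _ es1] exI[of _ vs2] exI[of _ es2]
      exI[of _ vs3] exI[of _ es3]) (simp add: assms)

lemma theta_partsE:
  assumes "theta_parts G E1 E2 E3"
  obtains u v vs1 es1 vs2 es2 vs3 es3 where "u \<noteq> v"
    "path_between G u v vs1 es1" "path_between G u v vs2 es2" "path_between G u v vs3 es3"
    "set vs1 \<inter> set vs2 = {u, v}" "set vs1 \<inter> set vs3 = {u, v}" "set vs2 \<inter> set vs3 = {u, v}"
    "set es1 \<inter> set es2 = {}" "set es1 \<inter> set es3 = {}" "set es2 \<inter> set es3 = {}"
    "E1 = set es1" "E2 = set es2" "E3 = set es3"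
  using assms unfolding theta_parts_def by (elim exE conjE) (rule that)

lemma theta_parts_theta:
  assumes "theta_parts G E1 E2 E3"
  shows "theta G (E1 \<union> E2 \<union> E3)"
  using assms
proof (rule theta_partsE)
  fix u v vs1 es1 vs2 es2 vs3 es3
  assume "u \<noteq> v"
    "path_between G u v vs1 es1" "path_between G u v vs2 es2" "path_between G u v vs3 es3"
    "set vs1 \<inter> set vs2 = {u, v}" "set vs1 \<inter> set vs3 = {u, v}" "set vs2 \<inter> set vs3 = {u, v}"
    "set es1 \<inter> set es2 = {}" "set es1 \<inter> set es3 = {}" "set es2 \<inter> set es3 = {}"
    "E1 = set es1" "E2 = set es2" "E3 = set es3"
  then show ?thesis
    unfolding theta_def
    by (intro exI[of _ u] exI[of _ v] exI[of _ vs1] exI[of _ es1] exI[of _ vs2] exI[of _ es2]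
        exI[of _ vs3] exI[of _ es3]) simp
qed

lemma theta_parts_swap12: "theta_parts G E1 E2 E3 \<Longrightarrow> theta_parts G E2 E1 E3"
  by (elim theta_partsE) (simp add: theta_partsI Int_commute)

lemma theta_parts_swap23: "theta_parts G E1 E2 E3 \<Longrightarrow> theta_parts G E1 E3 E2"
  by (elim theta_partsE) (simp add: theta_partsI Int_commute)

lemma theta_parts_disjoint:
  "theta_parts G E1 E2 E3 \<Longrightarrow> E1 \<inter> E2 = {} \<and> E1 \<inter> E3 = {} \<and> E2 \<inter> E3 = {}"
  by (elim theta_partsE) simp

lemma theta_parts_nonempty: "theta_parts G E1 E2 E3 \<Longrightarrow> E1 \<noteq> {}"
  by (elim theta_partsE) (simp add: path_edges_nonempty)

lemma theta_parts_circle: "theta_parts G E1 E2 E3 \<Longrightarrow> circle G (E1 \<union> E2)"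
  by (elim theta_partsE) (simp add: circle_of_paths)

section \<open>The circles contained in a theta graph\<close>

lemma all_or_none:
  assumes "\<And>es1 a b es2. es = es1 @ a # b # es2 \<Longrightarrow> a \<in> C \<longleftrightarrow> b \<in> C"
  shows "set es \<subseteq> C \<or> set es \<inter> C = {}"
  using assms
proof (induction es)
  case (Cons a es)
  have "set es \<subseteq> C \<or> set es \<inter> C = {}"
    using Cons.prems by (intro Cons.IH) (metis append_Cons)
  then show ?case using Cons.prems[of "[]"] by (cases es) auto
qed auto

text \<open>An interior node of the first path meets only two edges of the theta graph, and these
  are consecutive on the path. A circle has two edges at each of its nodes, so it contains both or
  neither.\<close>

lemma theta_part_all_or_none:
  assumes "graph G" "theta_parts G E1 E2 E3" "circle G C" "C \<subseteq> E1 \<union> E2 \<union> E3"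
  shows "E1 \<subseteq> C \<or> E1 \<inter> C = {}"
proof -
  obtain u v vs1 es1 vs2 es2 vs3 es3 where *:
     "path_between G u v vs1 es1" "path_between G u v vs2 es2" "path_between G u v vs3 es3"
     "set vs1 \<inter> set vs2 = {u, v}" "set vs1 \<inter> set vs3 = {u, v}"
     "E1 = set es1" "E2 = set es2" "E3 = set es3"
    by (rule theta_partsE[OF assms(2)])
  have "a \<in> C \<longleftrightarrow> b \<in> C" if es: "es1 = fs @ a # b # gs" for fs a b gs
  proof -
    obtain x where x: "x \<in> set vs1" "x \<noteq> u" "x \<noteq> v" "x \<in> ends G a" "x \<in> ends G b"
        "\<forall>g\<in>set es1. x \<in> ends G g \<longrightarrow> g = a \<or> g = b"
      using path_interior_node[of G u v vs1 fs a b gs] *(1) es by blast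
    have "x \<notin> set vs2" "x \<notin> set vs3" using x(1-3) *(4,5) by blast+
    then have "\<forall>g\<in>set es2 \<union> set es3. x \<notin> ends G g"
      using path_edge_nodes[OF *(2)] path_edge_nodes[OF *(3)] by blast
    then have only: "\<forall>g\<in>C. x \<in> ends G g \<longrightarrow> g = a \<or> g = b"
      using assms(4) x(6) unfolding *(6-8) by blast
    show ?thesis
      using circle_next_edge[OF assms(1,3) _ x(4)] circle_next_edge[OF assms(1,3) _ x(5)] only
      by metis
  qed
  then show ?thesis unfolding *(6) by (rule all_or_none)
qed

text \<open>By \<open>theta_part_all_or_none\<close> the circle is a union of whole paths. Each path
  has one edge at the common end \<open>u\<close>, and the circle has two edges there, so it uses
  exactly two of the paths.\<close>

lemma circle_in_theta:
  assumes G: "graph G" and th: "theta_parts G E1 E2 E3" and C: "circle G C" "C \<subseteq> E1 \<union> E2 \<union> E3"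
  shows "C = E1 \<union> E2 \<or> C = E1 \<union> E3 \<or> C = E2 \<union> E3"
proof -
  obtain u v vs1 es1 vs2 es2 vs3 es3 where *: "u \<noteq> v"
     "path_between G u v vs1 es1" "path_between G u v vs2 es2" "path_between G u v vs3 es3"
     "E1 = set es1" "E2 = set es2" "E3 = set es3"
    by (rule theta_partsE[OF th])
  obtain a1 where a1: "a1 \<in> E1" "u \<in> ends G a1" "\<forall>g\<in>E1. u \<in> ends G g \<longrightarrow> g = a1"
    using path_first_edge[OF *(2,1)] unfolding *(5) by blast
  obtain a2 where a2: "a2 \<in> E2" "u \<in> ends G a2" "\<forall>g\<in>E2. u \<in> ends G g \<longrightarrow> g = a2"
    using path_first_edge[OF *(3,1)] unfolding *(6) by blast
  obtain a3 where a3: "a3 \<in> E3" "u \<in> ends G a3" "\<forall>g\<in>E3. u \<in> ends G g \<longrightarrow> g = a3"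
    using path_first_edge[OF *(4,1)] unfolding *(7) by blast
  have C': "C \<subseteq> E2 \<union> E1 \<union> E3" "C \<subseteq> E3 \<union> E1 \<union> E2" using C(2) by auto
  have aon1: "E1 \<subseteq> C \<or> E1 \<inter> C = {}" by (rule theta_part_all_or_none[OF G th C])
  have aon2: "E2 \<subseteq> C \<or> E2 \<inter> C = {}"
    by (rule theta_part_all_or_none[OF G theta_parts_swap12[OF th] C(1) C'(1)])
  have aon3: "E3 \<subseteq> C \<or> E3 \<inter> C = {}"
    by (rule theta_part_all_or_none[OF G theta_parts_swap12[OF theta_parts_swap23[OF th]] C(1) C'(2)])
  have only: "g = a1 \<or> g = a2 \<or> g = a3" if "g \<in> C" "u \<in> ends G g" for g
  proof -
    have "g \<in> E1 \<or> g \<in> E2 \<or> g \<in> E3" using that(1) C(2) by blast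
    then show ?thesis using a1(3) a2(3) a3(3) that(2) by blast
  qed
  have ne: "a1 \<noteq> a2" "a1 \<noteq> a3" "a2 \<noteq> a3"
    using a1(1) a2(1) a3(1) theta_parts_disjoint[OF th] by auto
  \<comment> \<open>Being nonempty, the circle contains some whole path and hence passes through
    \<open>u\<close>. Its two edges at \<open>u\<close> are first edges of two different
    paths.\<close>
  have "C \<noteq> {}" using C(1) unfolding circle_def circle_seq_def by auto
  then obtain c where c: "c \<in> C" by blast
  then have "c \<in> E1 \<or> c \<in> E2 \<or> c \<in> E3" using C(2) by blast
  then have "E1 \<subseteq> C \<or> E2 \<subseteq> C \<or> E3 \<subseteq> C" using aon1 aon2 aon3 c by blast
  then have "a1 \<in> C \<or> a2 \<in> C \<or> a3 \<in> C" using a1(1) a2(1) a3(1) by blast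
  then obtain b where b: "b \<in> C" "b = a1 \<or> b = a2 \<or> b = a3" by blast
  then have "u \<in> ends G b" using a1(2) a2(2) a3(2) by blast
  from circle_next_edge[OF G C(1) b(1) this]
  obtain f where f: "f \<in> C" "f \<noteq> b" "u \<in> ends G f" "\<forall>g\<in>C. u \<in> ends G g \<longrightarrow> g = b \<or> g = f"
    by blast
  have f': "f = a1 \<or> f = a2 \<or> f = a3" using only f(1,3) by blast
  have "a1 \<in> C \<Longrightarrow> a1 = b \<or> a1 = f" "a2 \<in> C \<Longrightarrow> a2 = b \<or> a2 = f" "a3 \<in> C \<Longrightarrow> a3 = b \<or> a3 = f"
    using f(4) a1(2) a2(2) a3(2) by blast+
  then consider "a1 \<in> C" "a2 \<in> C" "a3 \<notin> C" | "a1 \<in> C" "a3 \<in> C" "a2 \<notin> C"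
    | "a2 \<in> C" "a3 \<in> C" "a1 \<notin> C"
    using b f(1,2) f' ne by metis
  then show ?thesis
  proof cases
    case 1
    then have "E1 \<subseteq> C" "E2 \<subseteq> C" "E3 \<inter> C = {}" using aon1 aon2 aon3 a1(1) a2(1) a3(1) by blast+
    then show ?thesis using C(2) by blast
  next
    case 2
    then have "E1 \<subseteq> C" "E3 \<subseteq> C" "E2 \<inter> C = {}" using aon1 aon2 aon3 a1(1) a2(1) a3(1) by blast+
    then show ?thesis using C(2) by blast
  next
    case 3
    then have "E2 \<subseteq> C" "E3 \<subseteq> C" "E1 \<inter> C = {}" using aon1 aon2 aon3 a1(1) a2(1) a3(1) by blast+
    then show ?thesis using C(2) by blast
  qed
qed

text \<open>The theta graph contains only three circles; with the third one unbalanced, it would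
  contain exactly two balanced circles.\<close>

lemma theta_closure:
  assumes "biased_graph \<Omega>" "theta_parts \<Omega> E1 E2 E3"
    and "E1 \<union> E2 \<in> balanced \<Omega>" "E1 \<union> E3 \<in> balanced \<Omega>"
  shows "E2 \<union> E3 \<in> balanced \<Omega>"
proof (rule ccontr)
  assume n: "E2 \<union> E3 \<notin> balanced \<Omega>"
  let ?T = "E1 \<union> E2 \<union> E3"
  have "C = E1 \<union> E2 \<or> C = E1 \<union> E3" if "C \<in> balanced \<Omega>" "C \<subseteq> ?T" for C
    using circle_in_theta[of \<Omega> E1 E2 E3 C] assms that n unfolding biased_graph_def by blast
  then have "{C \<in> balanced \<Omega>. C \<subseteq> ?T} = {E1 \<union> E2, E1 \<union> E3}" using assms by blast
  moreover have "E1 \<union> E2 \<noteq> E1 \<union> E3"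
    using theta_parts_disjoint[OF assms(2)]
      theta_parts_nonempty[OF theta_parts_swap12[OF assms(2)]] by blast
  ultimately have "card {C \<in> balanced \<Omega>. C \<subseteq> ?T} = 2" by simp
  moreover have "theta \<Omega> ?T" using assms(2) by (rule theta_parts_theta)
  ultimately show False using assms(1) unfolding biased_graph_def by blast
qed

text \<open>\<open>theta_replacement\<close> inducts on the part of the target path beyond the common initial segment
  (nodes \<open>us @ [x]\<close>) of the two paths: the target path is followed from \<open>x\<close> to its first node \<open>y\<close> on the
  current path, and the segment of the current path from \<open>x\<close> to \<open>y\<close> is exchanged for it.  The third
  path of the theta graph runs from \<open>x\<close> back to \<open>u\<close>, through \<open>e\<close> to \<open>v\<close>, and back to \<open>y\<close>.\<close>

lemma theta_replacement:
  assumes G: "graph G" and e: "e \<in> edges G" "ends G e = {u, v}"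
    and step: "\<And>E1 E2 E3. theta_parts G E1 E2 E3 \<Longrightarrow> E1 \<subseteq> set pes \<Longrightarrow> E2 \<subseteq> set res \<Longrightarrow>
      P (E1 \<union> E3) \<Longrightarrow> P (E2 \<union> E3)"
    and "path_between G u v ps pes" "e \<notin> set pes" "P (insert e (set pes))"
    and "path_between G u v rs res" "e \<notin> set res"
  shows "P (insert e (set res))"
proof -
  have uv: "u \<noteq> v" using G e graph_endsD by metis
  \<comment> \<open>The two paths share the initial segment with nodes \<open>us @ [x]\<close> and
    edges \<open>ae\<close>; after \<open>x\<close> the current path goes on with \<open>qs\<close>,
    \<open>qe\<close> and the target path with \<open>rs\<close>, \<open>re\<close>. After
    \<open>x\<close> the current path still uses edges of the original path only, so every segment
    removed from it lies in \<open>pes\<close>, as \<open>step\<close> requires.\<close>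
  have main: "P (insert e (set (ae @ re)))"
    if "walk G (us @ [x]) ae" "walk G (x # qs) qe" "walk G (x # rs) re"
      "distinct (us @ x # qs)" "distinct (us @ x # rs)" "hd (us @ [x]) = u"
      "last (x # qs) = v" "last (x # rs) = v"
      "set qe \<subseteq> set pes" "set re \<subseteq> set res" "e \<notin> set ae"
      "P (insert e (set (ae @ qe)))" for us x ae qs qe rs re
    using that
  proof (induction "length rs" arbitrary: us x ae qs qe rs re rule: less_induct)
    case less
    show ?case
    proof (cases "rs = []")
      case True
      then have "x = v" using less.prems(8) by simp
      then have "qs = []" using less.prems(4,7) by (cases qs rule: rev_cases) auto
      with True less.prems show ?thesis by (simp add: walk_single_iff)
    next
      case False
      \<comment> \<open>Both paths end at \<open>v\<close>, so the target path does meet the rest of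
        the current path after \<open>x\<close>, at the latest in \<open>v\<close>.\<close>
      then have "v \<in> set rs" using less.prems(8) last_in_set[of rs] by simp
      then have "x \<noteq> v" using less.prems(5) by auto
      then have "qs \<noteq> []" using less.prems(7) by auto
      then have "v \<in> set qs" using less.prems(7) last_in_set[of qs] by simp
      with \<open>v \<in> set rs\<close> obtain bs' y rs' where rs: "rs = bs' @ y # rs'" "y \<in> set qs"
          "\<forall>z\<in>set bs'. z \<notin> set qs"
        using split_list_first_prop[of rs "\<lambda>z. z \<in> set qs"] by blast
      obtain bs qs' where qs: "qs = bs @ y # qs'" using rs(2) split_list by fast
      obtain be qe' where qe: "qe = be @ qe'" and wb: "walk G ((x # bs) @ [y]) be"
          and wq: "walk G (y # qs') qe'"
        using walk_split[of G "x # bs" y qs' qe] less.prems(2) qs by auto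
      obtain be' re' where re: "re = be' @ re'" and wb': "walk G ((x # bs') @ [y]) be'"
          and wr: "walk G (y # rs') re'"
        using walk_split[of G "x # bs'" y rs' re] less.prems(3) rs(1) by auto
      have dq: "distinct (us @ x # bs @ y # qs')" using less.prems(4) qs by simp
      have dr: "distinct (us @ x # bs' @ y # rs')" using less.prems(5) rs(1) by simp
      have disj: "set bs' \<inter> set bs = {}" "set bs' \<inter> set qs' = {}" "y \<notin> set bs'"
        using rs(3) qs by auto
      have wa: "walk G ((us @ x # bs') @ [y]) (ae @ be')"
        using walk_append[OF less.prems(1), of "bs' @ [y]" be'] wb' by simp
      have esub: "set qe' \<subseteq> set pes" "set re' \<subseteq> set res" "set be \<subseteq> set pes" "set be' \<subseteq> set res"
        using less.prems(9,10) qe re by auto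
      have ene: "e \<notin> set be" "e \<notin> set be'" "e \<notin> set qe'"
        using esub assms(6,9) by auto
      have pb: "path_between G x y ((x # bs) @ [y]) be"
        using wb dq by (auto simp: path_between_def)
      have pb': "path_between G x y ((x # bs') @ [y]) be'"
        using wb' dr by (auto simp: path_between_def)
      have xy: "x \<noteq> y" using dq by auto
      \<comment> \<open>After the exchange the common initial segment extends to \<open>y\<close>,
        and a shorter piece of the target path remains.\<close>
      have goal: "P (insert e (set (ae @ re)))" if new: "P (insert e (set ((ae @ be') @ qe')))"
      proof -
        have "P (insert e (set ((ae @ be') @ re')))"
        proof (rule less.hyps[of rs' "us @ x # bs'" y "ae @ be'" qs' qe' re'])
          show "length rs' < length rs" using rs(1) by simp
          show "distinct ((us @ x # bs') @ y # qs')" using dq dr disj by auto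
          show "distinct ((us @ x # bs') @ y # rs')" using dr by simp
          show "hd ((us @ x # bs') @ [y]) = u" using less.prems(6) by (cases us) auto
          show "last (y # qs') = v" using less.prems(7) qs by simp
          show "last (y # rs') = v" using less.prems(8) rs(1) by simp
          show "e \<notin> set (ae @ be')" using less.prems(11) ene by simp
        qed (use wa wq wr esub new in auto)
        then show ?thesis using re by simp
      qed
      show ?thesis
      proof (cases "set be \<inter> set be' = {}")
        case False
        \<comment> \<open>The two segments have only the nodes \<open>x\<close> and \<open>y\<close>
          in common. A common edge therefore joins these nodes and makes up both segments, so the
          exchange changes nothing.\<close>
        then obtain g where g: "g \<in> set be" "g \<in> set be'" by blast
        have "ends G g \<subseteq> {x, y}"
          using path_edge_nodes[OF pb g(1)] path_edge_nodes[OF pb' g(2)] disj(1) by auto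
        moreover have "card (ends G g) = 2"
          using G path_subset_edges[OF pb] g(1) by (auto simp: graph_def)
        ultimately have "ends G g = {x, y}" using xy
          by (metis card_2_iff card_subset_eq finite.emptyI finite_insert)
        then have "be = [g]" "be' = [g]"
          using path_edge_joining_ends[OF pb g(1) _ xy] path_edge_joining_ends[OF pb' g(2) _ xy]
          by blast+
        then show ?thesis using goal less.prems(12) qe by simp
      next
        case True
        define ts where "ts = rev (us @ [x]) @ rev (y # qs')"
        define te where "te = rev ae @ e # rev qe'"
        have ends: "last (rev (us @ [x])) = u" "hd (rev (y # qs')) = v"
          using less.prems(6,7) qs by (simp_all only: last_rev hd_rev, simp)
        have wt: "walk G ts te" unfolding ts_def te_def
          using walk_join_edge[OF walk_rev[OF less.prems(1)] walk_rev[OF wq] e(1)] ends e(2)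
          by simp
        have "distinct ts" "hd ts = x" "last ts = y" using dq by (auto simp: ts_def)
        with wt have pt: "path_between G x y ts te" by (simp add: path_between_def)
        have st: "set ts = set us \<union> set qs' \<union> {x, y}" "set te = insert e (set ae \<union> set qe')"
          by (auto simp: ts_def te_def)
        have wab: "walk G (us @ x # bs @ [y]) (ae @ be)"
          using walk_append[OF less.prems(1), of "bs @ [y]" be] wb by simp
        have "distinct (ae @ qe)"
          using walk_append[OF less.prems(1,2)] less.prems(4) path_edges_distinct by blast
        then have d1: "set be \<inter> set ae = {}" "set be \<inter> set qe' = {}" using qe by auto
        have "distinct ((us @ x # bs') @ [y])" using dr by auto
        then have "distinct (ae @ be')" by (rule path_edges_distinct[OF wa])
        then have d2: "set be' \<inter> set ae = {}" by auto
        \<comment> \<open>The new segment and the current path from \<open>y\<close> onwards share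
          only the node \<open>y\<close>; a common edge would have no second end.\<close>
        have d3: "set be' \<inter> set qe' = {}"
        proof (rule ccontr)
          assume "set be' \<inter> set qe' \<noteq> {}"
          then obtain g where g: "g \<in> set be'" "g \<in> set qe'" by blast
          have "x \<notin> set (y # qs')" using dq by auto
          then have "ends G g \<subseteq> {y}"
            using path_edge_nodes[OF pb' g(1)] walk_subsets[OF wq] g(2) disj(2) by fastforce
          then have "card (ends G g) \<le> 1" using card_mono[of "{y}" "ends G g"] by simp
          moreover have "card (ends G g) = 2"
            using G path_subset_edges[OF pb'] g(1) by (auto simp: graph_def)
          ultimately show False by simp
        qed
        have "theta_parts G (set be) (set be') (set te)"
        proof (rule theta_partsI[OF pb pb' pt xy])
          show "set ((x # bs) @ [y]) \<inter> set ((x # bs') @ [y]) = {x, y}" using disj by auto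
          show "set ((x # bs) @ [y]) \<inter> set ts = {x, y}" using dq st(1) by auto
          show "set ((x # bs') @ [y]) \<inter> set ts = {x, y}" using dr st(1) disj by auto
          show "set be \<inter> set te = {}" "set be' \<inter> set te = {}"
            using st(2) d1 d2 d3 ene by auto
        qed (rule True)
        from step[OF this esub(3,4)] have "P (set be' \<union> set te)"
          if "P (set be \<union> set te)" using that by blast
        moreover have "set be \<union> set te = insert e (set (ae @ qe))"
          "set be' \<union> set te = insert e (set ((ae @ be') @ qe'))" using st(2) qe by auto
        ultimately show ?thesis using goal less.prems(12) by simp
      qed
    qed
  qed
  obtain ps' where ps: "ps = u # ps'" "distinct (u # ps')" "last (u # ps') = v" "walk G (u # ps') pes"
    using assms(5) by (cases ps) (auto simp: path_between_def walk_nonempty)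
  obtain rs' where rs: "rs = u # rs'" "distinct (u # rs')" "last (u # rs') = v" "walk G (u # rs') res"
    using assms(8) by (cases rs) (auto simp: path_between_def walk_nonempty)
  have "u \<in> nodes G" using G e by (auto simp: graph_def)
  then show ?thesis using main[of "[]" u "[]" ps' pes rs' res] ps rs assms(7) by simp
qed

subsection \<open>Lifts in a biased expansion\<close>

text \<open>Circles are identified with their edge sets, so a lift is a set too: the image of a
  section of \<open>p\<close> over \<open>E\<close>, with one edge from each fiber.\<close>

definition lift_of ::
    "('v, 'e) biased_mgraph \<Rightarrow> ('e \<Rightarrow> 'd) \<Rightarrow> 'e set \<Rightarrow> 'd set \<Rightarrow> bool" where
  "lift_of \<Omega> p X E \<longleftrightarrow> X \<subseteq> edges \<Omega> \<and> bij_betw p X E"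

lemma lift_of_union:
  "lift_of \<Omega> p X E \<Longrightarrow> lift_of \<Omega> p Y F \<Longrightarrow> E \<inter> F = {} \<Longrightarrow> lift_of \<Omega> p (X \<union> Y) (E \<union> F)"
  unfolding lift_of_def using bij_betw_combine by blast

lemma lift_of_single: "f \<in> edges \<Omega> \<Longrightarrow> lift_of \<Omega> p {f} {p f}"
  by (simp add: lift_of_def)

lemma lift_of_insert:
  "lift_of \<Omega> p X E \<Longrightarrow> f \<in> edges \<Omega> \<Longrightarrow> p f \<notin> E \<Longrightarrow> lift_of \<Omega> p (insert f X) (insert (p f) E)"
  using lift_of_union[of \<Omega> p "{f}" "{p f}" X E] lift_of_single by fastforce

lemma lift_of_split:
  assumes "lift_of \<Omega> p X (E \<union> F)" "E \<inter> F = {}"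
  obtains Y Z where "X = Y \<union> Z" "lift_of \<Omega> p Y E" "lift_of \<Omega> p Z F"
proof
  show "X = {x \<in> X. p x \<in> E} \<union> {x \<in> X. p x \<in> F}"
    using assms by (auto simp: lift_of_def bij_betw_def)
  show "lift_of \<Omega> p {x \<in> X. p x \<in> E} E" "lift_of \<Omega> p {x \<in> X. p x \<in> F} F"
    using assms by (auto simp: lift_of_def bij_betw_def inj_on_def)
qed

lemma lift_of_splitE:
  assumes "lift_of \<Omega> p X (insert e E)" "e \<notin> E"
  obtains f Y where "X = insert f Y" "lift_of \<Omega> p Y E" "f \<in> edges \<Omega>" "p f = e"
proof -
  obtain Z Y where X: "X = Z \<union> Y" "lift_of \<Omega> p Z {e}" "lift_of \<Omega> p Y E"
    using lift_of_split[of \<Omega> p X "{e}" E] assms by auto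
  then have Z: "Z \<subseteq> edges \<Omega>" "inj_on p Z" "p ` Z = {e}" by (auto simp: lift_of_def bij_betw_def)
  then obtain f where f: "f \<in> Z" by blast
  have "g = f" if "g \<in> Z" for g using inj_onD[OF Z(2) _ that f] Z(3) that f
    by (metis imageI singletonD)
  then have "Z = {f}" using f by blast
  then show thesis using that[of f Y] X(1,3) Z by simp
qed

context
  fixes \<Omega> :: "('v, 'e) biased_mgraph" and p :: "'e \<Rightarrow> 'd" and \<Delta> :: "('v, 'd) mgraph"
  assumes exp: "biased_expansion \<Omega> p \<Delta>"
begin

lemma exp_graphs: "graph \<Omega>" "graph \<Delta>" "biased_graph \<Omega>"
  using exp by (auto simp: biased_expansion_def biased_graph_def)

lemma exp_edge: "f \<in> edges \<Omega> \<Longrightarrow> p f \<in> edges \<Delta> \<and> ends \<Delta> (p f) = ends \<Omega> f"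
  using exp by (auto simp: biased_expansion_def)

lemma lift_of_exists:
  assumes "E \<subseteq> edges \<Delta>"
  shows "\<exists>X. lift_of \<Omega> p X E"
proof -
  have im: "E \<subseteq> p ` edges \<Omega>" using assms exp by (auto simp: biased_expansion_def)
  then show ?thesis unfolding lift_of_def bij_betw_def subset_image_inj by blast
qed

text \<open>The projection keeps the ends of edges, so the same list of nodes serves the path and
  each of its lifts.\<close>

lemma lift_of_path:
  assumes "path_between \<Delta> u v vs es" "lift_of \<Omega> p X (set es)"
  shows "\<exists>fs. path_between \<Omega> u v vs fs \<and> set fs = X"
proof -
  let ?h = "inv_into X p"
  have X: "X \<subseteq> edges \<Omega>" "bij_betw p X (set es)" using assms(2) by (auto simp: lift_of_def)
  then have im: "?h ` set es = X" by (metis bij_betw_def inv_into_image_cancel subset_refl)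
  have h: "?h e \<in> X \<and> p (?h e) = e" if "e \<in> set es" for e
    using that X(2) im by (metis bij_betw_inv_into_right imageI)
  have "ends \<Omega> (?h e) = ends \<Delta> e \<and> ?h e \<in> edges \<Omega>" if "e \<in> set es" for e
    using h[OF that] X(1) exp_edge[of "?h e"] by auto
  then have "path_between \<Omega> u v vs (map ?h es)"
    using exp by (intro path_map[OF assms(1)]) (simp_all add: biased_expansion_def)
  moreover have "set (map ?h es) = X" using im by simp
  ultimately show ?thesis by blast
qed

lemma lift_of_disjoint:
  "lift_of \<Omega> p X E \<Longrightarrow> lift_of \<Omega> p Y F \<Longrightarrow> E \<inter> F = {} \<Longrightarrow> X \<inter> Y = {}"
  by (auto simp: lift_of_def bij_betw_def)

text \<open>Lifted paths keep their nodes, and disjoint edge sets have disjoint lifts.\<close>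

lemma lift_of_theta:
  assumes th: "theta_parts \<Delta> E1 E2 E3"
    and X: "lift_of \<Omega> p X1 E1" "lift_of \<Omega> p X2 E2" "lift_of \<Omega> p X3 E3"
  shows "theta_parts \<Omega> X1 X2 X3"
proof -
  obtain u v vs1 es1 vs2 es2 vs3 es3 where *: "u \<noteq> v"
    "path_between \<Delta> u v vs1 es1" "path_between \<Delta> u v vs2 es2" "path_between \<Delta> u v vs3 es3"
    "set vs1 \<inter> set vs2 = {u, v}" "set vs1 \<inter> set vs3 = {u, v}" "set vs2 \<inter> set vs3 = {u, v}"
    "E1 = set es1" "E2 = set es2" "E3 = set es3"
    by (rule theta_partsE[OF th])
  obtain fs1 where f1: "path_between \<Omega> u v vs1 fs1" "set fs1 = X1"
    using lift_of_path[OF *(2)] X(1) *(8) by blast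
  obtain fs2 where f2: "path_between \<Omega> u v vs2 fs2" "set fs2 = X2"
    using lift_of_path[OF *(3)] X(2) *(9) by blast
  obtain fs3 where f3: "path_between \<Omega> u v vs3 fs3" "set fs3 = X3"
    using lift_of_path[OF *(4)] X(3) *(10) by blast
  have "X1 \<inter> X2 = {}" "X1 \<inter> X3 = {}" "X2 \<inter> X3 = {}"
    using lift_of_disjoint X theta_parts_disjoint[OF th] by blast+
  then show ?thesis
    using theta_partsI[OF f1(1) f2(1) f3(1) *(1,5-7)] f1(2) f2(2) f3(2) by simp
qed

text \<open>The theta property, used in both directions, makes two lifted paths interchangeable once
  they form a balanced circle with each other. All comparisons of balance below rest on this
  exchange.\<close>

lemma lift_of_theta_closure:
  assumes th: "theta_parts \<Delta> E1 E2 E3"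
    and X: "lift_of \<Omega> p X1 E1" "lift_of \<Omega> p X2 E2" "lift_of \<Omega> p X3 E3"
    and b: "X1 \<union> X2 \<in> balanced \<Omega>"
  shows "X1 \<union> X3 \<in> balanced \<Omega> \<longleftrightarrow> X2 \<union> X3 \<in> balanced \<Omega>"
proof -
  have t: "theta_parts \<Omega> X1 X2 X3" using lift_of_theta[OF th X] .
  have "X2 \<union> X3 \<in> balanced \<Omega>" if "X1 \<union> X3 \<in> balanced \<Omega>"
    using theta_closure[OF exp_graphs(3) t b that] .
  moreover have "X1 \<union> X3 \<in> balanced \<Omega>" if "X2 \<union> X3 \<in> balanced \<Omega>"
    using theta_closure[OF exp_graphs(3) theta_parts_swap12[OF t] _ that] b
    by (simp add: Un_commute)
  ultimately show ?thesis by blast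
qed

text \<open>This is the circle lifting property for edge sets instead of sequences: removing
  \<open>e\<close> from the circle lists the other edges as a path, and \<open>inv_into X p\<close>
  lists the given lift in the same order.\<close>

lemma circle_lift_edge:
  assumes "circle \<Delta> (insert e E)" "e \<notin> E" "lift_of \<Omega> p X E"
  shows "\<exists>!f. f \<in> edges \<Omega> \<and> p f = e \<and> insert f X \<in> balanced \<Omega>"
proof -
  have e: "e \<in> edges \<Delta>" using assms(1) circle_subset_edges by blast
  then obtain u v where uv: "ends \<Delta> e = {u, v}" using graph_endsE[OF exp_graphs(2)] by metis
  then obtain vs es where *: "path_between \<Delta> u v vs es" "e \<notin> set es" and ins: "insert e E = insert e (set es)"
    using circle_remove_edge[OF assms(1)] by blast
  have E: "E = set es" using insert_ident[OF assms(2) *(2)] ins by blast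
  have seq: "circle_seq \<Delta> (es @ [e])"
    using circle_seq_path_edge[OF *(1) exp_graphs(2) e uv *(2)] .
  let ?fs = "map (inv_into X p) es"
  have X: "X \<subseteq> edges \<Omega>" "bij_betw p X (set es)" using assms(3) E by (auto simp: lift_of_def)
  then have "inv_into X p ` set es = X" by (metis bij_betw_def inv_into_image_cancel subset_refl)
  then have fs: "set ?fs = X" by simp
  have "map p ?fs = es"
    using bij_betw_inv_into_right[OF X(2)] by (auto intro!: map_idI)
  then have "\<exists>!f. f \<in> edges \<Omega> \<and> p f = e \<and> set (?fs @ [f]) \<in> balanced \<Omega>"
    using exp seq fs X(1) unfolding biased_expansion_def circle_lifting_def by blast
  then show ?thesis using fs by simp
qed

text \<open>All edges of \<open>E\<close> except one are lifted arbitrarily; the lifting property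
  supplies the last one.\<close>

lemma circle_lift_part:
  assumes "circle \<Delta> (E \<union> F)" "E \<inter> F = {}" "E \<noteq> {}" "lift_of \<Omega> p Y F"
  shows "\<exists>X. lift_of \<Omega> p X E \<and> X \<union> Y \<in> balanced \<Omega>"
proof -
  obtain e where e: "e \<in> E" using assms(3) by blast
  have "E - {e} \<subseteq> edges \<Delta>" using assms(1) circle_subset_edges by blast
  then obtain Z where Z: "lift_of \<Omega> p Z (E - {e})" using lift_of_exists by blast
  have ZY: "lift_of \<Omega> p (Z \<union> Y) ((E - {e}) \<union> F)"
    using lift_of_union[OF Z assms(4)] assms(2) by blast
  have "insert e ((E - {e}) \<union> F) = E \<union> F" "e \<notin> (E - {e}) \<union> F" using e assms(2) by auto
  then obtain f where f: "f \<in> edges \<Omega>" "p f = e" "insert f (Z \<union> Y) \<in> balanced \<Omega>"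
    using circle_lift_edge[of e "(E - {e}) \<union> F" "Z \<union> Y"] ZY assms(1) by auto
  have "lift_of \<Omega> p (insert f Z) E"
    using lift_of_insert[OF Z f(1)] f(2) e by (simp add: insert_absorb)
  then show ?thesis using f(3) by auto
qed

text \<open>Two edges of a balanced circle in the same fiber would be parallel, so the circle would
  be a balanced digon inside a fiber. Hence \<open>p\<close> is injective on it, and the closed walk
  projects to a circle.\<close>

lemma balanced_lift_of:
  assumes "X \<in> balanced \<Omega>"
  shows "circle \<Delta> (p ` X) \<and> lift_of \<Omega> p X (p ` X)"
proof -
  have c: "circle \<Omega> X" using assms exp_graphs(3) by (auto simp: biased_graph_def)
  have XE: "X \<subseteq> edges \<Omega>" using circle_subset_edges[OF c] .
  have inj: "inj_on p X"
  proof (rule inj_onI, rule ccontr)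
    fix e f assume ef: "e \<in> X" "f \<in> X" "p e = p f" "e \<noteq> f"
    have "ends \<Omega> e = ends \<Omega> f" using exp_edge ef XE by (metis subsetD)
    then have "X = {e, f}" using circle_digon[OF exp_graphs(1) c] ef by blast
    then show False using exp ef XE assms by (auto simp: biased_expansion_def)
  qed
  obtain es vs where es: "distinct es" "es \<noteq> []" "X = set es" "walk \<Omega> vs es" "hd vs = last vs"
      "distinct (tl vs)"
    using c unfolding circle_def circle_seq_def by blast
  have "walk \<Delta> vs (map p es)"
    using exp XE exp_edge es(3) by (intro walk_map[OF es(4)]) (auto simp: biased_expansion_def)
  moreover have "distinct (map p es)" "map p es \<noteq> []" using es inj by (auto simp: distinct_map)
  ultimately have "circle_seq \<Delta> (map p es)" unfolding circle_seq_def using es(5,6) by blast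
  moreover have "p ` X = set (map p es)" using es(3) by simp
  ultimately show ?thesis using inj XE unfolding circle_def lift_of_def bij_betw_def by blast
qed

end

subsection \<open>Two expansions of the same graph\<close>

text \<open>Take an edge \<open>a\<close> at \<open>u\<close> and an edge \<open>b\<close> at
  \<open>v\<close>. A circle through both splits at \<open>u\<close> and \<open>v\<close> into the
  two paths. If there is none, then \<open>a = b\<close>, and any further edge would lie on a circle
  with \<open>a\<close>; so \<open>a\<close> is the only edge.\<close>

lemma two_connected_disjoint_paths:
  assumes G: "graph G" and tc: "two_connected G" and uv: "u \<in> nodes G" "v \<in> nodes G" "u \<noteq> v"
  shows "(\<exists>a. edges G = {a} \<and> ends G a = {u, v}) \<or>
    (\<exists>vs1 es1 vs2 es2. path_between G u v vs1 es1 \<and> path_between G u v vs2 es2 \<and>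
       set vs1 \<inter> set vs2 = {u, v} \<and> set es1 \<inter> set es2 = {})" (is "_ \<or> ?paths")
proof -
  \<comment> \<open>The circle is opened at \<open>a\<close>, which leaves a path from
    \<open>u\<close> to the other end \<open>y\<close> of \<open>a\<close>, and this path is cut at
    \<open>v\<close>. Its first piece is one of the paths sought; the edge \<open>a\<close> followed
    by the reversed second piece is the other.\<close>
  have on_circle: ?paths if C: "circle G C" "a \<in> C" "u \<in> ends G a" "b \<in> C" "v \<in> ends G b" for C a b
  proof -
    have aE: "a \<in> edges G" using C(1,2) circle_subset_edges by blast
    obtain a1 a2 where "ends G a = {a1, a2}" "a1 \<noteq> a2" using graph_endsE[OF G aE] by metis
    then obtain y where y: "ends G a = {u, y}" "u \<noteq> y" using C(3) by auto
    then obtain ws fs where ws: "path_between G u y ws fs" "a \<notin> set fs" "C = insert a (set fs)"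
      using circle_remove_edge[OF C(1,2)] by blast
    have "v \<in> set ws"
    proof (cases "b = a")
      case True
      then have "v = y" using y C(5) uv(3) by auto
      then show ?thesis using path_end_nodes[OF ws(1)] by simp
    next
      case False
      then have "b \<in> set fs" using C(4) ws(3) by simp
      then show ?thesis using path_edge_nodes[OF ws(1)] C(5) by blast
    qed
    then obtain w1 w2 where w: "ws = w1 @ v # w2" using split_list by fast
    have wk: "walk G (w1 @ v # w2) fs" and d: "distinct (w1 @ v # w2)"
      and hl: "hd (w1 @ v # w2) = u" "last (v # w2) = y"
      using ws(1) w by (auto simp: path_between_def)
    obtain f1 f2 where f: "fs = f1 @ f2" "walk G (w1 @ [v]) f1" "walk G (v # w2) f2"
      using walk_split[OF wk] by blast
    obtain w1' where w1: "w1 = u # w1'" using hl(1) uv(3) by (cases w1) auto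
    have p1: "path_between G u v (w1 @ [v]) f1"
      using f(2) d w1 by (auto simp: path_between_def)
    have "walk G [u] []" using uv(1) by simp
    moreover have "ends G a = {last [u], hd (rev (v # w2))}" using y(1) hl(2) by (simp only: hd_rev) simp
    ultimately have "walk G ([u] @ rev (v # w2)) ([] @ a # rev f2)"
      using walk_join_edge[OF _ walk_rev[OF f(3)] aE] by blast
    then have p2: "path_between G u v (u # rev (v # w2)) (a # rev f2)"
      using d w1 by (auto simp: path_between_def)
    have "distinct fs" using path_edges_distinct[OF wk d] .
    then have "set f1 \<inter> set (a # rev f2) = {}" using f(1) ws(2) by auto
    moreover have "set (w1 @ [v]) \<inter> set (u # rev (v # w2)) = {u, v}" using d w1 by auto
    ultimately show ?thesis using p1 p2 by blast
  qed
  obtain vs es where p: "path_between G u v vs es"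
    using tc uv unfolding two_connected_def connected_graph_def by blast
  obtain a where a: "a \<in> set es" "u \<in> ends G a" using path_first_edge[OF p uv(3)] by blast
  obtain b where b: "b \<in> set es" "v \<in> ends G b"
    using path_first_edge[OF path_rev[OF p]] uv(3) by auto
  have ab: "a \<in> edges G" "b \<in> edges G" using a b path_subset_edges[OF p] by auto
  show ?thesis
  proof (cases "\<exists>C. circle G C \<and> a \<in> C \<and> b \<in> C")
    case True
    then show ?thesis using on_circle a(2) b(2) by blast
  next
    case False
    then have eq: "a = b" using tc ab unfolding two_connected_def by blast
    have "edges G \<subseteq> {a}"
    proof
      fix c assume "c \<in> edges G"
      then show "c \<in> {a}" using tc ab(1) eq False unfolding two_connected_def by blast
    qed
    moreover have "ends G a = {u, v}"
      using graph_endsE[OF G ab(1)] a(2) b(2) eq uv(3) by (metis doubleton_eq_iff insertE singletonD)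
    ultimately show ?thesis using ab(1) by blast
  qed
qed

section \<open>Expansions that agree over an edge set \<open>E0\<close>, the edges of the smaller
  graph\<close>

context
  fixes \<Omega>' \<Omega>'' :: "('v, 'e) biased_mgraph" and p' p'' :: "'e \<Rightarrow> 'd"
    and \<Delta> :: "('v, 'd) mgraph" and E0 :: "'d set"
  assumes exp': "biased_expansion \<Omega>' p' \<Delta>" and exp'': "biased_expansion \<Omega>'' p'' \<Delta>"
    and edges_agree:
      "\<And>f e. e \<in> E0 \<Longrightarrow> f \<in> edges \<Omega>' \<and> p' f = e \<longleftrightarrow> f \<in> edges \<Omega>'' \<and> p'' f = e"
    and balanced_agree:
      "\<And>X E. E \<subseteq> E0 \<Longrightarrow> lift_of \<Omega>' p' X E \<Longrightarrow> X \<in> balanced \<Omega>' \<longleftrightarrow> X \<in> balanced \<Omega>''"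
begin

lemma lift_of_agree:
  assumes "E \<subseteq> E0"
  shows "lift_of \<Omega>' p' X E \<longleftrightarrow> lift_of \<Omega>'' p'' X E"
proof
  assume l: "lift_of \<Omega>' p' X E"
  have "x \<in> edges \<Omega>'' \<and> p'' x = p' x" if "x \<in> X" for x
  proof -
    have "x \<in> edges \<Omega>'" "p' x \<in> E0" using l that assms by (auto simp: lift_of_def bij_betw_def)
    then show ?thesis using edges_agree[of "p' x" x] by simp
  qed
  then show "lift_of \<Omega>'' p'' X E"
    using l bij_betw_cong[of X p' p'' E] unfolding lift_of_def by auto
next
  assume l: "lift_of \<Omega>'' p'' X E"
  have "x \<in> edges \<Omega>' \<and> p' x = p'' x" if "x \<in> X" for x
  proof -
    have "x \<in> edges \<Omega>''" "p'' x \<in> E0" using l that assms by (auto simp: lift_of_def bij_betw_def)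
    then show ?thesis using edges_agree[of "p'' x" x] by simp
  qed
  then show "lift_of \<Omega>' p' X E"
    using l bij_betw_cong[of X p' p'' E] unfolding lift_of_def by auto
qed

text \<open>Independence of the lift: the correspondence between the fibers over \<open>e\<close>
  found by closing one lift of \<open>P\<close> is the same for every other lift of
  \<open>P\<close>.\<close>

definition transfers :: "'d set \<Rightarrow> 'd \<Rightarrow> bool" where
  "transfers P e \<longleftrightarrow> (\<forall>X Y f g. lift_of \<Omega>' p' X P \<longrightarrow> lift_of \<Omega>' p' Y P \<longrightarrow>
     f \<in> edges \<Omega>' \<longrightarrow> p' f = e \<longrightarrow> g \<in> edges \<Omega>'' \<longrightarrow> p'' g = e \<longrightarrow>
     insert f X \<in> balanced \<Omega>' \<longrightarrow> insert g X \<in> balanced \<Omega>'' \<longrightarrow>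
     (insert f Y \<in> balanced \<Omega>' \<longleftrightarrow> insert g Y \<in> balanced \<Omega>''))"

lemma transfersD:
  "transfers P e \<Longrightarrow> lift_of \<Omega>' p' X P \<Longrightarrow> lift_of \<Omega>' p' Y P \<Longrightarrow>
     f \<in> edges \<Omega>' \<Longrightarrow> p' f = e \<Longrightarrow> g \<in> edges \<Omega>'' \<Longrightarrow> p'' g = e \<Longrightarrow>
     insert f X \<in> balanced \<Omega>' \<Longrightarrow> insert g X \<in> balanced \<Omega>'' \<Longrightarrow>
     insert f Y \<in> balanced \<Omega>' \<longleftrightarrow> insert g Y \<in> balanced \<Omega>''"
  unfolding transfers_def by blast

text \<open>A lift \<open>Z\<close> of \<open>Q\<close> that is balanced with \<open>X\<close>
  serves as a reference. By exchange, \<open>f\<close> also closes \<open>Z\<close>, and therefore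
  \<open>f\<close> closes \<open>Y\<close> exactly if \<open>Z\<close> does; the same holds for
  \<open>g\<close>. Whether \<open>Z \<union> Y\<close> is balanced is the same in both expansions,
  since it lies over \<open>E0\<close>.\<close>

lemma transfers_theta:
  assumes th: "theta_parts \<Delta> P Q {e}" and PQ: "P \<subseteq> E0" "Q \<subseteq> E0"
  shows "transfers P e"
  unfolding transfers_def
proof (intro allI impI)
  fix X Y f g
  assume X: "lift_of \<Omega>' p' X P" and Y: "lift_of \<Omega>' p' Y P"
    and f: "f \<in> edges \<Omega>'" "p' f = e" and g: "g \<in> edges \<Omega>''" "p'' g = e"
    and b: "insert f X \<in> balanced \<Omega>'" "insert g X \<in> balanced \<Omega>''"
  have th': "theta_parts \<Delta> Q {e} P" using theta_parts_swap12 theta_parts_swap23 th by metis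
  have "Q \<inter> P = {}" using theta_parts_disjoint[OF th] by blast
  then obtain Z where Z: "lift_of \<Omega>' p' Z Q" "Z \<union> X \<in> balanced \<Omega>'"
    using circle_lift_part[OF exp' theta_parts_circle[OF theta_parts_swap12[OF th]] _ _ X]
      theta_parts_nonempty[OF th'] by blast
  have "lift_of \<Omega>' p' (Z \<union> X) (Q \<union> P)" using lift_of_union[OF Z(1) X] \<open>Q \<inter> P = {}\<close> .
  then have ZX: "X \<union> Z \<in> balanced \<Omega>'" "X \<union> Z \<in> balanced \<Omega>''"
    using balanced_agree[of "Q \<union> P"] PQ Z(2) by (simp_all add: Un_commute)
  have lf: "lift_of \<Omega>' p' {f} {e}" and lg: "lift_of \<Omega>'' p'' {g} {e}"
    using lift_of_single f g by metis+
  have X'': "lift_of \<Omega>'' p'' X P" "lift_of \<Omega>'' p'' Y P" "lift_of \<Omega>'' p'' Z Q"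
    using X Y Z(1) lift_of_agree PQ by auto
  have "Z \<union> {f} \<in> balanced \<Omega>'"
    using lift_of_theta_closure[OF exp' th X Z(1) lf ZX(1)] b(1) by simp
  from lift_of_theta_closure[OF exp' th' Z(1) lf Y this]
  have 1: "Z \<union> Y \<in> balanced \<Omega>' \<longleftrightarrow> insert f Y \<in> balanced \<Omega>'" by simp
  have "Z \<union> {g} \<in> balanced \<Omega>''"
    using lift_of_theta_closure[OF exp'' th X''(1,3) lg ZX(2)] b(2) by simp
  from lift_of_theta_closure[OF exp'' th' X''(3) lg X''(2) this]
  have 2: "Z \<union> Y \<in> balanced \<Omega>'' \<longleftrightarrow> insert g Y \<in> balanced \<Omega>''" by simp
  have "lift_of \<Omega>' p' (Z \<union> Y) (Q \<union> P)" using lift_of_union[OF Z(1) Y] \<open>Q \<inter> P = {}\<close> .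
  then show "insert f Y \<in> balanced \<Omega>' \<longleftrightarrow> insert g Y \<in> balanced \<Omega>''"
    using 1 2 balanced_agree[of "Q \<union> P"] PQ by simp
qed

text \<open>A second path is missing when the smaller graph is a single edge. Over the digon on
  \<open>e\<close> and \<open>a\<close>, an edge in the fiber of \<open>e\<close> closes only one
  edge over \<open>a\<close>, so both sides of the equivalence say that \<open>Y\<close> equals
  \<open>X\<close>.\<close>

lemma transfers_single:
  assumes c: "circle \<Delta> {e, a}" "e \<noteq> a" and a: "a \<in> E0"
  shows "transfers {a} e"
  unfolding transfers_def
proof (intro allI impI)
  fix X Y f g
  assume X: "lift_of \<Omega>' p' X {a}" and Y: "lift_of \<Omega>' p' Y {a}"
    and f: "f \<in> edges \<Omega>'" "p' f = e" and g: "g \<in> edges \<Omega>''" "p'' g = e"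
    and b: "insert f X \<in> balanced \<Omega>'" "insert g X \<in> balanced \<Omega>''"
  obtain x where x: "X = {x}" "x \<in> edges \<Omega>'" "p' x = a"
    using lift_of_splitE[OF X] by (metis all_not_in_conv bij_betw_empty2 empty_iff lift_of_def)
  obtain y where y: "Y = {y}" "y \<in> edges \<Omega>'" "p' y = a"
    using lift_of_splitE[OF Y] by (metis all_not_in_conv bij_betw_empty2 empty_iff lift_of_def)
  have x'': "x \<in> edges \<Omega>''" "p'' x = a" "y \<in> edges \<Omega>''" "p'' y = a"
    using edges_agree[OF a] x y by blast+
  have c': "circle \<Delta> (insert a {e})" "a \<notin> {e}" using c by (auto simp: insert_commute)
  have lf: "lift_of \<Omega>' p' {f} {e}" and lg: "lift_of \<Omega>'' p'' {g} {e}"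
    using lift_of_single f g by metis+
  show "insert f Y \<in> balanced \<Omega>' \<longleftrightarrow> insert g Y \<in> balanced \<Omega>''"
  proof
    assume "insert f Y \<in> balanced \<Omega>'"
    then have "x = y"
      using circle_lift_edge[OF exp' c' lf] x y b(1) by (auto simp: insert_commute)
    then show "insert g Y \<in> balanced \<Omega>''" using b(2) x(1) y(1) by simp
  next
    assume "insert g Y \<in> balanced \<Omega>''"
    then have "x = y"
      using circle_lift_edge[OF exp'' c' lg] x'' x(1) y(1) b(2) by (auto simp: insert_commute)
    then show "insert f Y \<in> balanced \<Omega>'" using b(1) x(1) y(1) by simp
  qed
qed

section \<open>Preservation of balance\<close>

lemma lift_of_image:
  assumes "\<And>f. f \<in> edges \<Omega>' \<Longrightarrow> r f \<in> edges \<Omega>'' \<and> p'' (r f) = p' f" "lift_of \<Omega>' p' X E"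
  shows "lift_of \<Omega>'' p'' (r ` X) E"
proof -
  have X: "X \<subseteq> edges \<Omega>'" "inj_on p' X" "p' ` X = E"
    using assms(2) by (auto simp: lift_of_def bij_betw_def)
  have eq: "p'' (r x) = p' x" "r x \<in> edges \<Omega>''" if "x \<in> X" for x using assms(1) that X(1) by auto
  have "inj_on p'' (r ` X)"
    using X(2) eq(1) by (auto intro!: inj_onI dest: inj_onD)
  moreover have "p'' ` r ` X = E" using X(3) eq(1) by (auto simp: image_iff)
  ultimately show ?thesis using eq(2) by (auto simp: lift_of_def bij_betw_def)
qed

text \<open>For each edge outside \<open>E0\<close>, the assumption \<open>new\<close> provides one
  circle through it, with all other edges in \<open>E0\<close>, for which the claim is known.
  Exchanges of segments carry the claim from there to any circle through that edge.\<close>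

lemma balance_preserved:
  assumes r: "\<And>f. f \<in> edges \<Omega>' \<Longrightarrow> r f \<in> edges \<Omega>'' \<and> p'' (r f) = p' f"
    and old: "\<And>f. f \<in> edges \<Omega>' \<Longrightarrow> p' f \<in> E0 \<Longrightarrow> r f = f"
    and new: "\<And>e. e \<in> edges \<Delta> \<Longrightarrow> e \<notin> E0 \<Longrightarrow> \<exists>u v vs es. ends \<Delta> e = {u, v} \<and>
        path_between \<Delta> u v vs es \<and> set es \<subseteq> E0 \<and>
        (\<forall>X. lift_of \<Omega>' p' X (insert e (set es)) \<longrightarrow> (X \<in> balanced \<Omega>' \<longleftrightarrow> r ` X \<in> balanced \<Omega>''))"
    and C: "circle \<Delta> C"
  shows "\<forall>X. lift_of \<Omega>' p' X C \<longrightarrow> (X \<in> balanced \<Omega>' \<longleftrightarrow> r ` X \<in> balanced \<Omega>'')"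
  using C
proof (induction "card (C - E0)" arbitrary: C rule: less_induct)
  case less
  let ?P = "\<lambda>C. \<forall>X. lift_of \<Omega>' p' X C \<longrightarrow> (X \<in> balanced \<Omega>' \<longleftrightarrow> r ` X \<in> balanced \<Omega>'')"
  show ?case
  proof (cases "C \<subseteq> E0")
    case True
    show ?thesis
    proof (intro allI impI)
      fix X assume X: "lift_of \<Omega>' p' X C"
      then have "f \<in> edges \<Omega>' \<and> p' f \<in> E0" if "f \<in> X" for f
        using that True by (auto simp: lift_of_def bij_betw_def)
      then have "r f = f" if "f \<in> X" for f using old that by blast
      then have "r ` X = X" by simp
      then show "X \<in> balanced \<Omega>' \<longleftrightarrow> r ` X \<in> balanced \<Omega>''"
        using balanced_agree[OF True X] by simp
    qed
  next
    case False
    then obtain e where e: "e \<in> C" "e \<notin> E0" by blast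
    then have eD: "e \<in> edges \<Delta>" using circle_subset_edges[OF less.prems] by blast
    obtain u v ps pes where p: "ends \<Delta> e = {u, v}" "path_between \<Delta> u v ps pes" "set pes \<subseteq> E0"
        "?P (insert e (set pes))"
      using new[OF eD e(2)] by blast
    obtain rs res where rr: "path_between \<Delta> u v rs res" "e \<notin> set res" "C = insert e (set res)"
      using circle_remove_edge[OF less.prems e(1) p(1)] by blast
    have step: "?P (E2 \<union> E3)"
      if th: "theta_parts \<Delta> E1 E2 E3" and sub: "E1 \<subseteq> set pes" "E2 \<subseteq> set res" and P: "?P (E1 \<union> E3)"
      for E1 E2 E3
    proof (intro allI impI)
      fix X assume "lift_of \<Omega>' p' X (E2 \<union> E3)"
      moreover note disj = theta_parts_disjoint[OF th]
      ultimately obtain X2 X3 where X: "X = X2 \<union> X3" "lift_of \<Omega>' p' X2 E2" "lift_of \<Omega>' p' X3 E3"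
        using lift_of_split by metis
      \<comment> \<open>The lift \<open>X1\<close> is chosen balanced with \<open>X2\<close>. This
        lets \<open>X1\<close> replace \<open>X2\<close> in \<Omega>', and once the image of
        \<open>X1 \<union> X2\<close> is known to be balanced, the images can be exchanged in
        \<Omega>'' as well.\<close>
      obtain X1 where X1: "lift_of \<Omega>' p' X1 E1" "X1 \<union> X2 \<in> balanced \<Omega>'"
        using circle_lift_part[OF exp' theta_parts_circle[OF th] _ theta_parts_nonempty[OF th] X(2)]
          disj by blast
      \<comment> \<open>Since \<open>E1\<close> lies in \<open>E0\<close> and \<open>E2\<close> in
        \<open>C\<close> without \<open>e\<close>, the circle \<open>E1 \<union> E2\<close> falls
        under the induction hypothesis.\<close>
      have "(E1 \<union> E2) - E0 \<subseteq> C - E0 - {e}" using sub p(3) rr(2,3) by blast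
      moreover have "finite (C - E0)" using circle_finite[OF less.prems] by simp
      ultimately have "card ((E1 \<union> E2) - E0) < card (C - E0)"
        using e by (intro psubset_card_mono) auto
      then have "?P (E1 \<union> E2)" using less.hyps theta_parts_circle[OF th] by blast
      moreover have "lift_of \<Omega>' p' (X1 \<union> X2) (E1 \<union> E2)"
        using lift_of_union[OF X1(1) X(2)] disj by blast
      ultimately have "r ` (X1 \<union> X2) \<in> balanced \<Omega>''" using X1(2) by blast
      then have r12: "r ` X1 \<union> r ` X2 \<in> balanced \<Omega>''" by (simp add: image_Un)
      have "X1 \<union> X3 \<in> balanced \<Omega>' \<longleftrightarrow> r ` X1 \<union> r ` X3 \<in> balanced \<Omega>''"
        using P lift_of_union[OF X1(1) X(3)] disj by (simp add: image_Un)
      moreover have "X1 \<union> X3 \<in> balanced \<Omega>' \<longleftrightarrow> X2 \<union> X3 \<in> balanced \<Omega>'"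
        by (rule lift_of_theta_closure[OF exp' th X1(1) X(2,3) X1(2)])
      moreover have "r ` X1 \<union> r ` X3 \<in> balanced \<Omega>'' \<longleftrightarrow> r ` X2 \<union> r ` X3 \<in> balanced \<Omega>''"
        by (rule lift_of_theta_closure[OF exp'' th lift_of_image[OF r X1(1)]
              lift_of_image[OF r X(2)] lift_of_image[OF r X(3)] r12])
      ultimately show "X \<in> balanced \<Omega>' \<longleftrightarrow> r ` X \<in> balanced \<Omega>''" using X(1) by (simp add: image_Un)
    qed
    have "e \<notin> set pes" using p(3) e(2) by blast
    from theta_replacement[OF exp_graphs(2)[OF exp'] eD p(1), of pes res ?P, OF step p(2) this p(4) rr(1,2)]
    show ?thesis unfolding rr(3) .
  qed
qed

section \<open>The bijection between the edges\<close>

definition matched :: "'d set \<Rightarrow> 'e \<Rightarrow> 'e \<Rightarrow> bool" where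
  "matched P f g \<longleftrightarrow> (\<forall>X. lift_of \<Omega>' p' X P \<longrightarrow> (insert f X \<in> balanced \<Omega>' \<longleftrightarrow> insert g X \<in> balanced \<Omega>''))"

text \<open>Circle lifting gives a lift \<open>X\<close> of \<open>P\<close> closed by the given
  edge, and then a single edge of the other expansion that closes \<open>X\<close>. So
  \<open>X\<close> alone forces uniqueness, while \<open>transfers\<close> extends the agreement
  from \<open>X\<close> to all lifts of \<open>P\<close>.\<close>

lemma
  assumes c: "circle \<Delta> (insert e P)" "e \<notin> P" "P \<noteq> {}" and P: "P \<subseteq> E0"
    and tr: "transfers P e"
  shows matched_ex1_right: "f \<in> edges \<Omega>' \<Longrightarrow> p' f = e \<Longrightarrow> \<exists>!g. g \<in> edges \<Omega>'' \<and> p'' g = e \<and> matched P f g"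
    and matched_ex1_left: "g \<in> edges \<Omega>'' \<Longrightarrow> p'' g = e \<Longrightarrow> \<exists>!f. f \<in> edges \<Omega>' \<and> p' f = e \<and> matched P f g"
proof -
  have c': "circle \<Delta> (P \<union> {e})" "P \<inter> {e} = {}" using c by auto
  {
    assume f: "f \<in> edges \<Omega>'" "p' f = e"
    have lf: "lift_of \<Omega>' p' {f} {e}" using lift_of_single f by metis
    obtain X where X: "lift_of \<Omega>' p' X P" "insert f X \<in> balanced \<Omega>'"
      using circle_lift_part[OF exp' c' c(3) lf] by auto
    have X'': "lift_of \<Omega>'' p'' X P" using X(1) lift_of_agree[OF P] by blast
    have ex1: "\<exists>!g. g \<in> edges \<Omega>'' \<and> p'' g = e \<and> insert g X \<in> balanced \<Omega>''"
      using circle_lift_edge[OF exp'' c(1,2) X''] .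
    then obtain g where g: "g \<in> edges \<Omega>''" "p'' g = e" "insert g X \<in> balanced \<Omega>''" by blast
    have "matched P f g"
      unfolding matched_def using transfersD[OF tr X(1) _ f g(1,2) X(2) g(3)] by blast
    with g(1,2) show "\<exists>!g. g \<in> edges \<Omega>'' \<and> p'' g = e \<and> matched P f g"
      using ex1 X unfolding matched_def by blast
  }
  {
    assume g: "g \<in> edges \<Omega>''" "p'' g = e"
    have lg: "lift_of \<Omega>'' p'' {g} {e}" using lift_of_single g by metis
    obtain X where X'': "lift_of \<Omega>'' p'' X P" "insert g X \<in> balanced \<Omega>''"
      using circle_lift_part[OF exp'' c' c(3) lg] by auto
    have X: "lift_of \<Omega>' p' X P" using X''(1) lift_of_agree[OF P] by blast
    have ex1: "\<exists>!f. f \<in> edges \<Omega>' \<and> p' f = e \<and> insert f X \<in> balanced \<Omega>'"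
      using circle_lift_edge[OF exp' c(1,2) X] .
    then obtain f where f: "f \<in> edges \<Omega>'" "p' f = e" "insert f X \<in> balanced \<Omega>'" by blast
    have "matched P f g"
      unfolding matched_def using transfersD[OF tr X _ f(1,2) g f(3) X''(2)] by blast
    with f(1,2) show "\<exists>!f. f \<in> edges \<Omega>' \<and> p' f = e \<and> matched P f g"
      using ex1 X X''(2) unfolding matched_def by blast
  }
qed

text \<open>The map is the identity over \<open>E0\<close>, where both expansions have the same
  edges. Over any other edge \<open>e\<close> it is the matching along a chosen path
  \<open>P e\<close>, a bijection of fibers because matching is unique on either side.\<close>

lemma edge_bijection_exists:
  assumes new: "\<And>e. e \<in> edges \<Delta> \<Longrightarrow> e \<notin> E0 \<Longrightarrow> \<exists>u v vs es. ends \<Delta> e = {u, v} \<and>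
        path_between \<Delta> u v vs es \<and> set es \<subseteq> E0 \<and> transfers (set es) e"
  shows "\<exists>r. bij_betw r (edges \<Omega>') (edges \<Omega>'') \<and> (\<forall>f\<in>edges \<Omega>'. p'' (r f) = p' f) \<and>
    (\<forall>f\<in>edges \<Omega>'. p' f \<in> E0 \<longrightarrow> r f = f) \<and> image r ` balanced \<Omega>' = balanced \<Omega>''"
proof -
  have "\<exists>P u v vs es. ends \<Delta> e = {u, v} \<and>
      path_between \<Delta> u v vs es \<and> set es = P \<and> P \<subseteq> E0 \<and> transfers P e" if "e \<in> edges \<Delta> - E0" for e
    using new[of e] that by (metis DiffD1 DiffD2)
  then obtain P where P: "\<And>e. e \<in> edges \<Delta> - E0 \<Longrightarrow> \<exists>u v vs es. ends \<Delta> e = {u, v} \<and>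
        path_between \<Delta> u v vs es \<and> set es = P e \<and> P e \<subseteq> E0 \<and> transfers (P e) e"
    by metis
  have P': "circle \<Delta> (insert e (P e)) \<and> e \<notin> P e \<and> P e \<noteq> {} \<and> P e \<subseteq> E0 \<and> transfers (P e) e"
    if e': "e \<in> edges \<Delta> - E0" for e
  proof -
    obtain u v vs es where *: "ends \<Delta> e = {u, v}" "path_between \<Delta> u v vs es" "set es = P e"
        "P e \<subseteq> E0" "transfers (P e) e"
      using P[OF e'] by blast
    have e: "e \<in> edges \<Delta>" "e \<notin> set es" using e' *(3,4) by auto
    have "u \<noteq> v" using graph_endsD[OF exp_graphs(2)[OF exp'] e(1) *(1)] .
    then have "es \<noteq> []" using path_edges_nonempty[OF *(2)] by blast
    moreover have "circle \<Delta> (set (es @ [e]))"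
      using circle_seq_path_edge[OF *(2) exp_graphs(2)[OF exp'] e(1) *(1) e(2)]
      unfolding circle_def by blast
    ultimately show ?thesis using * e by auto
  qed
  define r where "r f = (if p' f \<in> E0 then f
      else THE g. g \<in> edges \<Omega>'' \<and> p'' g = p' f \<and> matched (P (p' f)) f g)" for f
  have r_old: "r f = f \<and> f \<in> edges \<Omega>'' \<and> p'' f = p' f" if "f \<in> edges \<Omega>'" "p' f \<in> E0" for f
    using that edges_agree[of "p' f" f] by (simp add: r_def)
  have r_new: "r f \<in> edges \<Omega>'' \<and> p'' (r f) = p' f \<and> matched (P (p' f)) f (r f)"
    if "f \<in> edges \<Omega>'" "p' f \<notin> E0" for f
  proof -
    have "p' f \<in> edges \<Delta> - E0" using that exp_edge[OF exp'] by blast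
    from P'[OF this] have "\<exists>!g. g \<in> edges \<Omega>'' \<and> p'' g = p' f \<and> matched (P (p' f)) f g"
      using matched_ex1_right that(1) by blast
    from theI'[OF this] show ?thesis using that(2) by (simp add: r_def)
  qed
  have r: "r f \<in> edges \<Omega>'' \<and> p'' (r f) = p' f" if "f \<in> edges \<Omega>'" for f
    using r_old[OF that] r_new[OF that] by (cases "p' f \<in> E0") auto
  have inj: "inj_on r (edges \<Omega>')"
  proof (rule inj_onI)
    fix f1 f2 assume f: "f1 \<in> edges \<Omega>'" "f2 \<in> edges \<Omega>'" "r f1 = r f2"
    then have eq: "p' f1 = p' f2" using r by metis
    show "f1 = f2"
    proof (cases "p' f1 \<in> E0")
      case True
      then show ?thesis using r_old f eq by metis
    next
      case False
      have e: "p' f1 \<in> edges \<Delta> - E0" using False f(1) exp_edge[OF exp'] by blast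
      have "matched (P (p' f1)) f1 (r f1)" "matched (P (p' f1)) f2 (r f1)"
        using r_new f False eq by metis+
      moreover have "\<exists>!x. x \<in> edges \<Omega>' \<and> p' x = p' f1 \<and> matched (P (p' f1)) x (r f1)"
        using matched_ex1_left P'[OF e] r[OF f(1)] by blast
      ultimately show ?thesis using f eq by metis
    qed
  qed
  have surj: "\<exists>f\<in>edges \<Omega>'. r f = g" if g: "g \<in> edges \<Omega>''" for g
  proof (cases "p'' g \<in> E0")
    case True
    then have "g \<in> edges \<Omega>'" "p' g \<in> E0" using edges_agree[of "p'' g" g] g by auto
    then show ?thesis using r_old by blast
  next
    case False
    then have e: "p'' g \<in> edges \<Delta> - E0" using exp_edge[OF exp''] g by blast
    then obtain f where f: "f \<in> edges \<Omega>'" "p' f = p'' g" "matched (P (p'' g)) f g"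
      using matched_ex1_left P'[OF e] g by blast
    moreover have "\<exists>!x. x \<in> edges \<Omega>'' \<and> p'' x = p'' g \<and> matched (P (p'' g)) f x"
      using matched_ex1_right P'[OF e] f(1,2) by blast
    ultimately have "r f = g" using r_new[OF f(1)] False g by metis
    then show ?thesis using f(1) by blast
  qed
  have bij: "bij_betw r (edges \<Omega>') (edges \<Omega>'')"
    unfolding bij_betw_def using inj surj r by blast
  have pres: "X \<in> balanced \<Omega>' \<longleftrightarrow> r ` X \<in> balanced \<Omega>''"
    if "circle \<Delta> C" "lift_of \<Omega>' p' X C" for C X
  proof -
    have "\<forall>X. lift_of \<Omega>' p' X C \<longrightarrow> (X \<in> balanced \<Omega>' \<longleftrightarrow> r ` X \<in> balanced \<Omega>'')"
    proof (rule balance_preserved[OF r _ _ that(1)])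
      fix e assume e: "e \<in> edges \<Delta>" "e \<notin> E0"
      then have e': "e \<in> edges \<Delta> - E0" by blast
      obtain u v vs es where *: "ends \<Delta> e = {u, v}" "path_between \<Delta> u v vs es" "set es = P e"
          "P e \<subseteq> E0" using P[OF e'] by blast
      have "X \<in> balanced \<Omega>' \<longleftrightarrow> r ` X \<in> balanced \<Omega>''"
        if X: "lift_of \<Omega>' p' X (insert e (set es))" for X
      proof -
        have "e \<notin> set es" using * e by auto
        then obtain f Y where Y: "X = insert f Y" "lift_of \<Omega>' p' Y (P e)" "f \<in> edges \<Omega>'" "p' f = e"
          using lift_of_splitE[OF X] *(3) by metis
        \<comment> \<open>The map fixes the lift \<open>Y\<close> of \<open>P e\<close>, so only
          \<open>f\<close> is moved, and \<open>matched\<close> is then the required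
          equivalence.\<close>
        have "y \<in> edges \<Omega>' \<and> p' y \<in> E0" if "y \<in> Y" for y
          using Y(2) *(4) that by (auto simp: lift_of_def bij_betw_def)
        then have "r y = y" if "y \<in> Y" for y using r_old that by blast
        then have "r ` Y = Y" by simp
        then have "r ` X = insert (r f) Y" using Y(1) by simp
        moreover have "matched (P e) f (r f)" using r_new[OF Y(3)] Y(4) e(2) by simp
        ultimately show ?thesis using Y(1,2) unfolding matched_def by simp
      qed
      then show "\<exists>u v vs es. ends \<Delta> e = {u, v} \<and> path_between \<Delta> u v vs es \<and> set es \<subseteq> E0 \<and>
        (\<forall>X. lift_of \<Omega>' p' X (insert e (set es)) \<longrightarrow> (X \<in> balanced \<Omega>' \<longleftrightarrow> r ` X \<in> balanced \<Omega>''))"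
        using * by blast
    qed (use r_old in auto)
    then show ?thesis using that(2) by blast
  qed
  have "image r ` balanced \<Omega>' = balanced \<Omega>''"
  proof (intro equalityI subsetI)
    fix Y assume "Y \<in> image r ` balanced \<Omega>'"
    then obtain X where "Y = r ` X" "X \<in> balanced \<Omega>'" by blast
    then show "Y \<in> balanced \<Omega>''" using pres balanced_lift_of[OF exp'] by blast
  next
    \<comment> \<open>A balanced circle of \<Omega>'' is pulled back along the bijection. As the
      projections are respected, its preimage is a lift of the same circle of \<Delta>, and
      \<open>pres\<close> applies.\<close>
    fix Y assume Y: "Y \<in> balanced \<Omega>''"
    have Yl: "circle \<Delta> (p'' ` Y)" "lift_of \<Omega>'' p'' Y (p'' ` Y)"
      using balanced_lift_of[OF exp'' Y] by auto
    then have "Y \<subseteq> r ` edges \<Omega>'" using bij by (auto simp: lift_of_def bij_betw_def)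
    then obtain X where X: "X \<subseteq> edges \<Omega>'" "Y = r ` X" by (meson subset_imageE)
    have peq: "p' x = p'' (r x)" if "x \<in> X" for x using r X(1) that by auto
    have inj'': "inj_on p'' (r ` X)" using Yl(2) X(2) by (simp add: lift_of_def bij_betw_def)
    have "inj_on p' X"
    proof (rule inj_onI)
      fix x y assume xy: "x \<in> X" "y \<in> X" "p' x = p' y"
      then have "p'' (r x) = p'' (r y)" using peq by simp
      then have "r x = r y" using inj_onD[OF inj''] xy(1,2) by blast
      then show "x = y" using inj_onD[OF inj] xy X(1) by blast
    qed
    moreover have "p' ` X = p'' ` Y" unfolding X(2) image_image using peq by (rule image_cong[OF refl])
    ultimately have "lift_of \<Omega>' p' X (p'' ` Y)" using X(1) by (simp add: lift_of_def bij_betw_def)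
    then have "X \<in> balanced \<Omega>'" using pres[OF Yl(1)] Y X(2) by blast
    then show "Y \<in> image r ` balanced \<Omega>'" using X(2) by blast
  qed
  moreover have "\<forall>f\<in>edges \<Omega>'. p'' (r f) = p' f" "\<forall>f\<in>edges \<Omega>'. p' f \<in> E0 \<longrightarrow> r f = f"
    using r r_old by simp_all
  ultimately show ?thesis using bij by blast
qed

end

section \<open>Comparison of two extensions of one expansion\<close>

theorem theorem3p2:
  fixes \<Omega> \<Omega>' \<Omega>'' :: "('v, 'e) biased_mgraph"
    and \<Delta> \<Delta>' :: "('v, 'd) mgraph"
    and p p' p'' :: "'e \<Rightarrow> 'd"
  assumes "biased_expansion \<Omega> p \<Delta>"
    and "two_connected \<Delta>"
    and "extension \<Omega> p \<Delta> \<Omega>' p' \<Delta>'"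
    and "extension \<Omega> p \<Delta> \<Omega>'' p'' \<Delta>'"
  shows "(\<exists>!\<rho>. biased_graph_iso \<Omega>' \<Omega>'' \<rho> \<and> identity_on \<Omega> \<rho> \<and>
              commutes_with_projections \<Omega>' p' p'' \<rho>) \<and>
         (simple \<Delta>' \<longrightarrow>
            (\<forall>\<rho>. biased_graph_iso \<Omega>' \<Omega>'' \<rho> \<and> identity_on \<Omega> \<rho> \<longrightarrow>
                 commutes_with_projections \<Omega>' p' p'' \<rho>))"
proof -
  let ?E0 = "edges \<Delta>"
  have exp': "biased_expansion \<Omega>' p' \<Delta>'" and exp'': "biased_expansion \<Omega>'' p'' \<Delta>'"
    and sub: "nodes \<Delta> = nodes \<Delta>'" "?E0 \<subseteq> edges \<Delta>'" "\<And>e. e \<in> ?E0 \<Longrightarrow> ends \<Delta> e = ends \<Delta>' e"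
    using assms(3,4) by (auto simp: extension_def spanning_subgraph_def)
  have edg': "edges \<Omega> = {e \<in> edges \<Omega>'. p' e \<in> ?E0}" "\<forall>e\<in>edges \<Omega>. p e = p' e"
      "balanced \<Omega> = {C \<in> balanced \<Omega>'. C \<subseteq> edges \<Omega>}"
    using assms(3) unfolding extension_def by blast+
  have edg'': "edges \<Omega> = {e \<in> edges \<Omega>''. p'' e \<in> ?E0}" "\<forall>e\<in>edges \<Omega>. p e = p'' e"
      "balanced \<Omega> = {C \<in> balanced \<Omega>''. C \<subseteq> edges \<Omega>}"
    using assms(4) unfolding extension_def by blast+
  have nodes: "nodes \<Omega> = nodes \<Delta>" "nodes \<Omega>' = nodes \<Delta>'" "nodes \<Omega>'' = nodes \<Delta>'"
    using assms(1) exp' exp'' by (auto simp: biased_expansion_def)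
  have G: "graph \<Delta>" "graph \<Delta>'" using exp_graphs assms(1) exp' by blast+
  have edges_agree: "f \<in> edges \<Omega>' \<and> p' f = e \<longleftrightarrow> f \<in> edges \<Omega>'' \<and> p'' f = e" if "e \<in> ?E0" for f e
  proof -
    have "f \<in> edges \<Omega>' \<and> p' f = e \<longleftrightarrow> f \<in> edges \<Omega> \<and> p f = e" using that edg' by auto
    also have "\<dots> \<longleftrightarrow> f \<in> edges \<Omega>'' \<and> p'' f = e" using that edg'' by auto
    finally show ?thesis .
  qed
  \<comment> \<open>A lift of edges of \<Delta> consists of edges of \<Omega>, and on these both
    extensions inherit the balanced circles of \<Omega>.\<close>
  have balanced_agree: "X \<in> balanced \<Omega>' \<longleftrightarrow> X \<in> balanced \<Omega>''" if "E \<subseteq> ?E0" "lift_of \<Omega>' p' X E" for X E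
  proof -
    have "X \<subseteq> edges \<Omega>" using that edg'(1) by (auto simp: lift_of_def bij_betw_def)
    then show ?thesis using edg'(3) edg''(3) by blast
  qed
  have to_\<Delta>': "path_between \<Delta>' u v vs es" if "path_between \<Delta> u v vs es" for u v vs es
  proof -
    have "path_between \<Delta>' u v vs (map (\<lambda>e. e) es)"
      by (rule path_map[OF that]) (use sub path_subset_edges[OF that] in auto)
    then show ?thesis by simp
  qed
  \<comment> \<open>Every new edge is bypassed by a path in \<Delta> along which its two fibers can
    be compared.\<close>
  have detour: "\<exists>u v vs es. ends \<Delta>' e = {u, v} \<and> path_between \<Delta>' u v vs es \<and> set es \<subseteq> ?E0 \<and>
      transfers \<Omega>' \<Omega>'' p' p'' (set es) e" if e: "e \<in> edges \<Delta>'" "e \<notin> ?E0" for e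
  proof -
    obtain u v where uv: "ends \<Delta>' e = {u, v}" "u \<noteq> v" "u \<in> nodes \<Delta>'" "v \<in> nodes \<Delta>'"
      using graph_endsE[OF G(2) e(1)] .
    have "(\<exists>a. edges \<Delta> = {a} \<and> ends \<Delta> a = {u, v}) \<or>
      (\<exists>vs1 es1 vs2 es2. path_between \<Delta> u v vs1 es1 \<and> path_between \<Delta> u v vs2 es2 \<and>
       set vs1 \<inter> set vs2 = {u, v} \<and> set es1 \<inter> set es2 = {})"
      using two_connected_disjoint_paths[OF G(1) assms(2)] uv sub(1) by simp
    then show ?thesis
    proof (elim disjE exE conjE)
      \<comment> \<open>Here \<Delta> is a single edge \<open>a\<close>, parallel to
        \<open>e\<close>, and the digon on both takes the place of the theta graph.\<close>
      fix a assume a: "edges \<Delta> = {a}" "ends \<Delta> a = {u, v}"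
      have p: "path_between \<Delta>' u v [u, v] [a]"
        using path_single_edge[OF _ a(2) uv(2) G(1)] a(1) by (intro to_\<Delta>') simp
      have ea: "e \<noteq> a" using e(2) a(1) by blast
      have "circle_seq \<Delta>' ([a] @ [e])"
        using circle_seq_path_edge[OF p G(2) e(1) uv(1)] ea by simp
      then have "circle \<Delta>' (set ([a] @ [e]))" unfolding circle_def by blast
      then have c: "circle \<Delta>' {e, a}" by (simp add: insert_commute)
      have "a \<in> ?E0" using a(1) by simp
      from transfers_single[OF exp' exp'' _ _ c ea this] edges_agree balanced_agree
      have "transfers \<Omega>' \<Omega>'' p' p'' {a} e" by blast
      then have "transfers \<Omega>' \<Omega>'' p' p'' (set [a]) e" "set [a] \<subseteq> ?E0" using a(1) by simp_all
      then show ?thesis using p uv(1) by blast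
    next
      fix vs1 es1 vs2 es2
      assume *: "path_between \<Delta> u v vs1 es1" "path_between \<Delta> u v vs2 es2"
        "set vs1 \<inter> set vs2 = {u, v}" "set es1 \<inter> set es2 = {}"
      have es: "set es1 \<subseteq> ?E0" "set es2 \<subseteq> ?E0" 
        using path_subset_edges[OF *(1)] path_subset_edges[OF *(2)] by auto
      have "set vs1 \<inter> set [u, v] = {u, v}" "set vs2 \<inter> set [u, v] = {u, v}"
        using *(3) by auto
      moreover have "set es1 \<inter> set [e] = {}" "set es2 \<inter> set [e] = {}"
        using es e(2) by auto
      ultimately have "theta_parts \<Delta>' (set es1) (set es2) (set [e])"
        by (intro theta_partsI[OF to_\<Delta>'[OF *(1)] to_\<Delta>'[OF *(2)]
            path_single_edge[OF e(1) uv(1,2) G(2)] uv(2) *(3) _ _ *(4)])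
      then have "theta_parts \<Delta>' (set es1) (set es2) {e}" by simp
      from transfers_theta[OF exp' exp'' _ _ this es] edges_agree balanced_agree
      have "transfers \<Omega>' \<Omega>'' p' p'' (set es1) e" by blast
      then show ?thesis using to_\<Delta>'[OF *(1)] uv(1) es by blast
    qed
  qed

  \<comment> \<open>Construction of the isomorphism\<close>
  have "\<exists>r. bij_betw r (edges \<Omega>') (edges \<Omega>'') \<and> (\<forall>f\<in>edges \<Omega>'. p'' (r f) = p' f) \<and>
      (\<forall>f\<in>edges \<Omega>'. p' f \<in> ?E0 \<longrightarrow> r f = f) \<and> image r ` balanced \<Omega>' = balanced \<Omega>''"
  proof (rule edge_bijection_exists[OF exp' exp'', of ?E0])
    show "e \<in> ?E0 \<Longrightarrow> f \<in> edges \<Omega>' \<and> p' f = e \<longleftrightarrow> f \<in> edges \<Omega>'' \<and> p'' f = e" for e f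
      by (rule edges_agree)
    show "E \<subseteq> ?E0 \<Longrightarrow> lift_of \<Omega>' p' X E \<Longrightarrow> X \<in> balanced \<Omega>' \<longleftrightarrow> X \<in> balanced \<Omega>''" for X E
      by (rule balanced_agree)
    show "e \<in> edges \<Delta>' \<Longrightarrow> e \<notin> ?E0 \<Longrightarrow> \<exists>u v vs es. ends \<Delta>' e = {u, v} \<and> path_between \<Delta>' u v vs es \<and>
        set es \<subseteq> ?E0 \<and> transfers \<Omega>' \<Omega>'' p' p'' (set es) e" for e
      by (rule detour)
  qed
  then obtain r where r: "bij_betw r (edges \<Omega>') (edges \<Omega>'')" "\<forall>f\<in>edges \<Omega>'. p'' (r f) = p' f"
      "\<forall>f\<in>edges \<Omega>'. p' f \<in> ?E0 \<longrightarrow> r f = f" "image r ` balanced \<Omega>' = balanced \<Omega>''"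
    by (elim exE conjE) (rule that)
  define \<rho> where "\<rho> = (restrict (\<lambda>v. v) (nodes \<Omega>'), restrict r (edges \<Omega>'))"
  have balE: "C \<subseteq> edges \<Omega>'" if "C \<in> balanced \<Omega>'" for C
    using balanced_lift_of[OF exp' that] by (simp add: lift_of_def)
  have "(\<lambda>C. snd \<rho> ` C) ` balanced \<Omega>' = image r ` balanced \<Omega>'"
    using balE by (intro image_cong refl) (auto simp: \<rho>_def subset_iff)
  moreover have "bij_betw (snd \<rho>) (edges \<Omega>') (edges \<Omega>'')"
    using r(1) bij_betw_cong[of "edges \<Omega>'" "snd \<rho>" r] by (simp add: \<rho>_def)
  moreover have "bij_betw (fst \<rho>) (nodes \<Omega>') (nodes \<Omega>'')"
    using nodes by (auto simp: \<rho>_def bij_betw_def inj_on_def)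
  moreover have "ends \<Omega>'' (snd \<rho> e) = fst \<rho> ` ends \<Omega>' e" if e: "e \<in> edges \<Omega>'" for e
  proof -
    have "r e \<in> edges \<Omega>''" using r(1) e by (auto simp: bij_betw_def)
    then have "ends \<Omega>'' (r e) = ends \<Omega>' e"
      using exp_edge[OF exp''] exp_edge[OF exp' e] bspec[OF r(2) e] by metis
    moreover have "ends \<Omega>' e \<subseteq> nodes \<Omega>'" using exp_graphs(1)[OF exp'] e by (auto simp: graph_def)
    then have "fst \<rho> ` ends \<Omega>' e = ends \<Omega>' e" by (auto simp: \<rho>_def image_iff subset_iff)
    ultimately show ?thesis using e by (simp add: \<rho>_def)
  qed
  ultimately have iso: "biased_graph_iso \<Omega>' \<Omega>'' \<rho>"
    using r(4) by (simp add: biased_graph_iso_def graph_iso_def \<rho>_def)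
  have idn: "identity_on \<Omega> \<rho>"
    using r(3) edg'(1) nodes sub(1) by (auto simp: identity_on_def \<rho>_def)
  have com: "commutes_with_projections \<Omega>' p' p'' \<rho>"
    using r(2) by (simp add: commutes_with_projections_def \<rho>_def)

  \<comment> \<open>Uniqueness of the isomorphism\<close>
  have unique: "snd \<sigma> f = snd \<tau> f"
    if s: "biased_graph_iso \<Omega>' \<Omega>'' \<sigma>" "identity_on \<Omega> \<sigma>" "commutes_with_projections \<Omega>' p' p'' \<sigma>"
    and t: "biased_graph_iso \<Omega>' \<Omega>'' \<tau>" "identity_on \<Omega> \<tau>" "commutes_with_projections \<Omega>' p' p'' \<tau>"
    and f: "f \<in> edges \<Omega>'" for \<sigma> \<tau> f
  proof (cases "p' f \<in> ?E0")
    case True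
    then have "f \<in> edges \<Omega>" using f edg'(1) by blast
    then show ?thesis using s(2) t(2) by (simp add: identity_on_def)
  next
    case False
    have e: "p' f \<in> edges \<Delta>'" using exp_edge[OF exp' f] by blast
    obtain u v vs es where *: "ends \<Delta>' (p' f) = {u, v}" "path_between \<Delta>' u v vs es" "set es \<subseteq> ?E0"
      using detour[OF e False] by blast
    have ne: "p' f \<notin> set es" using False *(3) by blast
    have c: "circle \<Delta>' (insert (p' f) (set es))"
      using circle_seq_path_edge[OF *(2) G(2) e *(1) ne] unfolding circle_def by fastforce
    have "es \<noteq> []" using path_edges_nonempty[OF *(2) graph_endsD[OF G(2) e *(1)]] .
    \<comment> \<open>An admissible isomorphism fixes the lift \<open>X\<close> of the detour, which
      lies in \<Omega>. It therefore sends \<open>f\<close> to an edge over \<open>p' f\<close> that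
      closes \<open>X\<close> to a balanced circle of \<Omega>'', and there is only one such
      edge.\<close>
    then obtain X where X: "lift_of \<Omega>' p' X (set es)" "insert f X \<in> balanced \<Omega>'"
      using circle_lift_part[OF exp', of "set es" "{p' f}" "{f}"] c ne lift_of_single[OF f, of p'] by auto
    have XE: "X \<subseteq> edges \<Omega>" using X(1) *(3) edg'(1) by (auto simp: lift_of_def bij_betw_def)
    have X'': "lift_of \<Omega>'' p'' X (set es)"
      using lift_of_agree[OF exp' exp'' edges_agree balanced_agree *(3), where X = X] X(1) by simp
    have "snd \<phi> f \<in> edges \<Omega>'' \<and> p'' (snd \<phi> f) = p' f \<and> insert (snd \<phi> f) X \<in> balanced \<Omega>''"
      if "biased_graph_iso \<Omega>' \<Omega>'' \<phi>" "identity_on \<Omega> \<phi>" "commutes_with_projections \<Omega>' p' p'' \<phi>" for \<phi>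
    proof -
      have "snd \<phi> ` insert f X \<in> balanced \<Omega>''"
        using that(1) X(2) unfolding biased_graph_iso_def by blast
      moreover have "snd \<phi> ` X = X"
        using that(2) XE by (auto simp: identity_on_def image_iff subset_iff)
      moreover have "snd \<phi> f \<in> edges \<Omega>''"
        using that(1) f unfolding biased_graph_iso_def graph_iso_def bij_betw_def by blast
      moreover have "p'' (snd \<phi> f) = p' f"
        using that(3) f unfolding commutes_with_projections_def by blast
      ultimately show ?thesis by simp
    qed
    from this[OF s] this[OF t] show ?thesis
      using circle_lift_edge[OF exp'' c ne X''] by blast
  qed
  have "\<sigma> = \<rho>"
    if s: "biased_graph_iso \<Omega>' \<Omega>'' \<sigma>" "identity_on \<Omega> \<sigma>" "commutes_with_projections \<Omega>' p' p'' \<sigma>" for \<sigma>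
  proof (rule prod_eqI)
    have "fst \<sigma> \<in> extensional (nodes \<Omega>')" "fst \<rho> \<in> extensional (nodes \<Omega>')"
        "snd \<sigma> \<in> extensional (edges \<Omega>')" "snd \<rho> \<in> extensional (edges \<Omega>')"
      using s(1) iso by (auto simp: biased_graph_iso_def graph_iso_def)
    moreover have "fst \<sigma> v = fst \<rho> v" if "v \<in> nodes \<Omega>'" for v
      using s(3) com that by (simp add: commutes_with_projections_def)
    moreover have "snd \<sigma> f = snd \<rho> f" if "f \<in> edges \<Omega>'" for f
      using unique[OF s iso idn com that] .
    ultimately show "fst \<sigma> = fst \<rho>" "snd \<sigma> = snd \<rho>" using extensionalityI by blast+
  qed
  then have ex1: "\<exists>!\<rho>. biased_graph_iso \<Omega>' \<Omega>'' \<rho> \<and> identity_on \<Omega> \<rho> \<and>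
      commutes_with_projections \<Omega>' p' p'' \<rho>"
    using iso idn com by blast

  \<comment> \<open>Commutation with the projections over a simple graph\<close>
  have "commutes_with_projections \<Omega>' p' p'' \<sigma>"
    if simp: "simple \<Delta>'" and s: "biased_graph_iso \<Omega>' \<Omega>'' \<sigma>" "identity_on \<Omega> \<sigma>" for \<sigma>
  proof -
    \<comment> \<open>As \<Delta> spans \<Delta>', all nodes belong to \<Omega> and are fixed. An
      edge and its image then project to edges with the same ends, and these coincide in a simple
      graph.\<close>
    have fid: "fst \<sigma> v = v" if "v \<in> nodes \<Omega>'" for v
      using s(2) that nodes sub(1) by (simp add: identity_on_def)
    have "p'' (snd \<sigma> e) = p' e" if e: "e \<in> edges \<Omega>'" for e
    proof -
      have se: "snd \<sigma> e \<in> edges \<Omega>''" "ends \<Omega>'' (snd \<sigma> e) = fst \<sigma> ` ends \<Omega>' e"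
        using s(1) e by (auto simp: biased_graph_iso_def graph_iso_def bij_betw_def)
      have "ends \<Omega>' e \<subseteq> nodes \<Omega>'" using exp_graphs(1)[OF exp'] e by (auto simp: graph_def)
      then have "fst \<sigma> ` ends \<Omega>' e = ends \<Omega>' e" using fid by (auto simp: image_iff subset_iff)
      then have "ends \<Delta>' (p'' (snd \<sigma> e)) = ends \<Delta>' (p' e)"
        using exp_edge[OF exp'' se(1)] exp_edge[OF exp' e] se(2) by simp
      then show ?thesis
        using simp exp_edge[OF exp'' se(1)] exp_edge[OF exp' e] by (auto simp: simple_def inj_on_def)
    qed
    then show ?thesis using fid by (simp add: commutes_with_projections_def)
  qed
  with ex1 show ?thesis by blast
qed

end
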